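(* Let $\Omega_i=\mathbb R^p$ for all $i$. Suppose the graph $\mathcal G$ is connected, $\mathbf L=U^\top U$ satisfies the graph and null-space conditions given in the context with $\lambda_{\max}(\mathbf L)\le1$, and each $f_i:\mathbb R^p\to\mathbb R$ is differentiable with $L_i$-Lipschitz gradient and is $\mu_i$-strongly convex ($\mu_i>0$); put $\mu=\min_i\mu_i$, $L=\max_iL_i$, $\kappa_{\mathbf f}=L/\mu$, $\kappa_{\mathbf L}=1/\tilde\lambda_{\min}(\mathbf L)$. Let $c\in(0,\frac1{2L})$. Then the number of iterations needed by Mirror-EXTRA to reach $\varepsilon$-accuracy is of the order $O\big(\kappa_{\mathbf L}\kappa_{\mathbf f}\ln(1/\varepsilon)\big)$. That is, there is a constant $C>0$ depending only on the value $cL\in(0,\frac12)$ (not on the problem data or graph otherwise), and a constant $M>0$ independent of $k$ and $\varepsilon$ (but possibly depending on the problem, the graph, the parameter $c$ and the initialization), such that for every $\varepsilon\in(0,1)$ and every integer $k\ge C\kappa_{\mathbf L}\kappa_{\mathbf f}\ln(1/\varepsilon)$ one has $\|\mathbf x^k-\mathbf x^*\|_{\mathrm F}^2\le M\varepsilon$, where $\mathbf x^*$ is the optimal solution of the problem of minimizing $\sum_if_i(x_i)$ subject to $\sum_i(x_i-r_i)=0$.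
   Context: Agents $i=1,\dots,n$ have $f_i:\mathbb R^p\to\mathbb R$ and $r_i\in\mathbb R^p$. Points are matrices $\mathbf x\in\mathbb R^{n\times p}$ with $i$-th row $x_i^\top$. A function $f$ is $\mu$-strongly convex if $\langle\nabla f(x)-\nabla f(y),x-y\rangle\ge\mu\|x-y\|_2^2$ for all $x,y$. $\lambda_{\max}$ is the largest eigenvalue and $\tilde\lambda_{\min}$ the smallest nonzero eigenvalue of a symmetric positive semidefinite matrix; $\|\cdot\|_{\mathrm F}$ is the Frobenius norm. Graph. $\mathcal G$ is a simple undirected graph on $\{1,\dots,n\}$ with edge set $\mathcal E$ and neighbor sets $\mathcal N_i$. The $n\times n$ matrix $\mathbf L=[L_{ij}]$ is compatible with $\mathcal G$ (that is, $L_{ij}=0$ whenever $i\ne j$ and $\{i,j\}\notin\mathcal E$) and $\mathbf L=U^\top U$ for some full-row-rank $U\in\mathbb R^{(n-1)\times n}$ with null space $\{a\mathbf 1: a\in\mathbb R\}$. Algorithm (Mirror-EXTRA). Each agent $i$ initializes with arbitrary $x_i^0\in\mathbb R^p$ and $y_i^{-1}=0$. For $k=0,1,\dots$: $y_i^k=y_i^{k-1}+\sum_{j\in\mathcal N_i\cup\{i\}}L_{ij}\nabla f_j(x_j^k)$; $x_i^{k+1}=r_i-2cy_i^k+cy_i^{k-1}$. *)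

theory Defs
  imports
    "Jordan_Normal_Form.Spectral_Radius"
    "Jordan_Normal_Form.Matrix_Kernel"
    "Jordan_Normal_Form.DL_Rank"
begin

text \<open>
  The constant in the complexity bound has to be uniform in the number n of agents and in the
  dimension p, so both are quantified inside one formula. Therefore \<open>\<real>\<^sup>p\<close> is
  \<^term>\<open>carrier_vec p\<close> and \<open>\<real>\<^sup>n\<^sup>\<times>\<^sup>p\<close> is \<^term>\<open>carrier_mat n p\<close>. Agents are numbered
  \<open>0, ..., n - 1\<close>, and values of an objective outside \<^term>\<open>carrier_vec p\<close> play no role.
\<close>

definition enorm :: "real vec \<Rightarrow> real" where
  "enorm v = sqrt (v \<bullet> v)"

definition frobenius_norm :: "real mat \<Rightarrow> real" where
  "frobenius_norm A = sqrt (\<Sum>i<dim_row A. \<Sum>j<dim_col A. (A $$ (i, j))\<^sup>2)"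


text \<open>\<^term>\<open>carrier_vec p\<close> is not a type, so the Frechet derivative is spelled out.\<close>

definition has_gradient :: "nat \<Rightarrow> (real vec \<Rightarrow> real) \<Rightarrow> real vec \<Rightarrow> real vec \<Rightarrow> bool" where
  "has_gradient p f x g \<longleftrightarrow> g \<in> carrier_vec p \<and>
     (\<forall>e>0. \<exists>d>0. \<forall>y\<in>carrier_vec p. enorm (y - x) < d \<longrightarrow>
        \<bar>f y - f x - g \<bullet> (y - x)\<bar> \<le> e * enorm (y - x))"

definition differentiable_fun :: "nat \<Rightarrow> (real vec \<Rightarrow> real) \<Rightarrow> bool" where
  "differentiable_fun p f \<longleftrightarrow> (\<forall>x\<in>carrier_vec p. \<exists>g. has_gradient p f x g)"

definition gradient :: "nat \<Rightarrow> (real vec \<Rightarrow> real) \<Rightarrow> real vec \<Rightarrow> real vec" where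
  "gradient p f x = (THE g. has_gradient p f x g)"

lemma enorm_smult: "enorm (t \<cdot>\<^sub>v v) = \<bar>t\<bar> * enorm v"
proof -
  have "(t \<cdot>\<^sub>v v) \<bullet> (t \<cdot>\<^sub>v v) = t\<^sup>2 * (v \<bullet> v)"
    by (simp add: scalar_prod_def sum_distrib_left power2_eq_square algebra_simps)
  then show ?thesis
    by (simp add: enorm_def real_sqrt_mult)
qed

lemma scalar_prod_self_nonneg: "v \<bullet> (v :: real vec) \<ge> 0"
  by (auto simp: scalar_prod_def intro!: sum_nonneg)

lemma enorm_square: "(enorm v)\<^sup>2 = v \<bullet> v"
  by (simp add: enorm_def scalar_prod_self_nonneg)

lemma enorm_eq_0:
  assumes "v \<in> carrier_vec p" "enorm v = 0"
  shows "v = 0\<^sub>v p"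
proof -
  have "v \<bullet> v = 0"
    using assms(2) enorm_square[of v] by simp
  then have "(\<Sum>i<dim_vec v. v $ i * v $ i) = 0"
    by (simp add: scalar_prod_def atLeast0LessThan)
  then have "\<forall>i<dim_vec v. v $ i = 0"
    by (subst (asm) sum_nonneg_eq_0_iff) auto
  then show ?thesis
    using assms(1) by auto
qed

lemma has_gradient_unique:
  assumes x: "x \<in> carrier_vec p"
    and g: "has_gradient p f x g" and h: "has_gradient p f x h"
  shows "g = h"
proof -
  have gc: "g \<in> carrier_vec p" and hc: "h \<in> carrier_vec p"
    using g h by (auto simp: has_gradient_def)
  define w where "w = g - h"
  have wc: "w \<in> carrier_vec p"
    using gc hc by (simp add: w_def)
  have w0: "enorm w \<ge> 0"
    by (simp add: enorm_def scalar_prod_self_nonneg)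
  have bound: "enorm w \<le> 2 * e" if e: "e > 0" for e
  proof (cases "enorm w = 0")
    case True
    then show ?thesis using e by simp
  next
    case False
    with w0 have wp: "enorm w > 0" by simp
    obtain d1 where d1: "d1 > 0" and
      b1: "\<And>y. y \<in> carrier_vec p \<Longrightarrow> enorm (y - x) < d1 \<Longrightarrow>
             \<bar>f y - f x - g \<bullet> (y - x)\<bar> \<le> e * enorm (y - x)"
      using g e unfolding has_gradient_def by blast
    obtain d2 where d2: "d2 > 0" and
      b2: "\<And>y. y \<in> carrier_vec p \<Longrightarrow> enorm (y - x) < d2 \<Longrightarrow>
             \<bar>f y - f x - h \<bullet> (y - x)\<bar> \<le> e * enorm (y - x)"
      using h e unfolding has_gradient_def by blast
    define t where "t = min d1 d2 / (2 * enorm w)"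
    have t: "t > 0"
      using d1 d2 wp by (simp add: t_def)
    define y where "y = x + t \<cdot>\<^sub>v w"
    have yc: "y \<in> carrier_vec p"
      using x wc by (simp add: y_def)
    have yx: "y - x = t \<cdot>\<^sub>v w"
      using x wc by (auto simp: y_def)
    have ny: "enorm (y - x) = t * enorm w"
      using t by (simp add: yx enorm_smult)
    have "t * enorm w = min d1 d2 / 2"
      using wp by (simp add: t_def)
    then have small: "enorm (y - x) < d1" "enorm (y - x) < d2"
      using d1 d2 ny by auto
    have "\<bar>g \<bullet> (y - x) - h \<bullet> (y - x)\<bar> \<le> 2 * (e * enorm (y - x))"
      using b1[OF yc small(1)] b2[OF yc small(2)] by linarith
    moreover have "g \<bullet> (y - x) - h \<bullet> (y - x) = t * (enorm w)\<^sup>2"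
    proof -
      have "g \<bullet> (t \<cdot>\<^sub>v w) - h \<bullet> (t \<cdot>\<^sub>v w) = w \<bullet> (t \<cdot>\<^sub>v w)"
        using minus_scalar_prod_distrib[of g p h "t \<cdot>\<^sub>v w"] gc hc wc unfolding w_def by simp
      also have "\<dots> = t * (w \<bullet> w)"
        using wc by simp
      finally show ?thesis
        by (simp only: yx enorm_square)
    qed
    ultimately have "t * (enorm w)\<^sup>2 \<le> 2 * (e * (t * enorm w))"
      using ny t by (simp add: abs_mult)
    then have "(t * enorm w) * enorm w \<le> (t * enorm w) * (2 * e)"
      by (simp add: power2_eq_square algebra_simps)
    then show ?thesis
      using t wp by simp
  qed
  have "enorm w = 0"
    using bound[of "enorm w / 4"] w0 by (cases "enorm w = 0") auto
  then have "w = 0\<^sub>v p"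
    using enorm_eq_0 wc by blast
  then have "g $ i - h $ i = 0" if "i < p" for i
    using that gc hc by (metis w_def carrier_vecD index_minus_vec(1) index_zero_vec(1))
  then show ?thesis
    using gc hc by (intro eq_vecI) auto
qed

lemma gradient_eq:
  assumes "x \<in> carrier_vec p" "has_gradient p f x g"
  shows "gradient p f x = g"
  unfolding gradient_def using assms has_gradient_unique by blast

definition lipschitz_gradient :: "nat \<Rightarrow> (real vec \<Rightarrow> real) \<Rightarrow> real \<Rightarrow> bool" where
  "lipschitz_gradient p f K \<longleftrightarrow> (\<forall>x\<in>carrier_vec p. \<forall>y\<in>carrier_vec p.
     enorm (gradient p f x - gradient p f y) \<le> K * enorm (x - y))"

definition strongly_convex :: "nat \<Rightarrow> (real vec \<Rightarrow> real) \<Rightarrow> real \<Rightarrow> bool" where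
  "strongly_convex p f m \<longleftrightarrow> (\<forall>x\<in>carrier_vec p. \<forall>y\<in>carrier_vec p.
     (gradient p f x - gradient p f y) \<bullet> (x - y) \<ge> m * (enorm (x - y))\<^sup>2)"


definition lambda_max :: "real mat \<Rightarrow> real" where
  "lambda_max A = Max (spectrum A)"

definition lambda_min_nonzero :: "real mat \<Rightarrow> real" where
  "lambda_min_nonzero A = Min (spectrum A - {0})"


definition simple_graph :: "nat \<Rightarrow> nat set set \<Rightarrow> bool" where
  "simple_graph n E \<longleftrightarrow> E \<subseteq> {{i, j} | i j. i < n \<and> j < n \<and> i \<noteq> j}"

definition connected_graph :: "nat \<Rightarrow> nat set set \<Rightarrow> bool" where
  "connected_graph n E \<longleftrightarrow> (\<forall>i<n. \<forall>j<n. (i, j) \<in> {(u, v). {u, v} \<in> E}\<^sup>*)"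

definition neighbors :: "nat set set \<Rightarrow> nat \<Rightarrow> nat set" where
  "neighbors E i = {j. {i, j} \<in> E}"

definition graph_compatible :: "nat \<Rightarrow> nat set set \<Rightarrow> real mat \<Rightarrow> bool" where
  "graph_compatible n E A \<longleftrightarrow> A \<in> carrier_mat n n \<and>
     (\<forall>i<n. \<forall>j<n. i \<noteq> j \<and> {i, j} \<notin> E \<longrightarrow> A $$ (i, j) = 0)"

text \<open>
  \<^term>\<open>vec_space.rank (n - 1) U\<close> is the dimension of the column space of \<open>U\<close> inside
  \<open>\<real>\<^sup>n\<^sup>-\<^sup>1\<close>; full row rank means that it equals the number of rows.
\<close>

definition laplacian_factor :: "nat \<Rightarrow> real mat \<Rightarrow> bool" where
  "laplacian_factor n U \<longleftrightarrow> U \<in> carrier_mat (n - 1) n \<and>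
     vec_space.rank (n - 1) U = n - 1 \<and>
     mat_kernel U = {a \<cdot>\<^sub>v vec n (\<lambda>_. 1) | a. True}"


text \<open>
  The state after k iterations is the pair of the matrices with rows \<open>x_i^k\<close> and \<open>y_i^{k-1}\<close>;
  in particular the second component starts at \<open>y^{-1} = 0\<close>.
\<close>

primrec mirror_extra_state ::
  "nat \<Rightarrow> nat \<Rightarrow> nat set set \<Rightarrow> real mat \<Rightarrow> (nat \<Rightarrow> real vec \<Rightarrow> real) \<Rightarrow> (nat \<Rightarrow> real vec) \<Rightarrow> real
    \<Rightarrow> real mat \<Rightarrow> nat \<Rightarrow> real mat \<times> real mat" where
  "mirror_extra_state n p E A f r c X0 0 = (X0, 0\<^sub>m n p)"
| "mirror_extra_state n p E A f r c X0 (Suc k) =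
    (let (X, Y) = mirror_extra_state n p E A f r c X0 k;
         Y' = mat\<^sub>r n p (\<lambda>i. row Y i +
                finsum_vec TYPE(real) p (\<lambda>j. A $$ (i, j) \<cdot>\<^sub>v gradient p (f j) (row X j))
                  (neighbors E i \<union> {i}));
         X' = mat\<^sub>r n p (\<lambda>i. r i - (2 * c) \<cdot>\<^sub>v row Y' i + c \<cdot>\<^sub>v row Y i)
     in (X', Y'))"

definition mirror_extra ::
  "nat \<Rightarrow> nat \<Rightarrow> nat set set \<Rightarrow> real mat \<Rightarrow> (nat \<Rightarrow> real vec \<Rightarrow> real) \<Rightarrow> (nat \<Rightarrow> real vec) \<Rightarrow> real
    \<Rightarrow> real mat \<Rightarrow> nat \<Rightarrow> real mat" where
  "mirror_extra n p E A f r c X0 k = fst (mirror_extra_state n p E A f r c X0 k)"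


definition feasible_point :: "nat \<Rightarrow> nat \<Rightarrow> (nat \<Rightarrow> real vec) \<Rightarrow> real mat \<Rightarrow> bool" where
  "feasible_point n p r X \<longleftrightarrow> X \<in> carrier_mat n p \<and>
     finsum_vec TYPE(real) p (\<lambda>i. row X i - r i) {..<n} = 0\<^sub>v p"

definition optimal_solution ::
  "nat \<Rightarrow> nat \<Rightarrow> (nat \<Rightarrow> real vec \<Rightarrow> real) \<Rightarrow> (nat \<Rightarrow> real vec) \<Rightarrow> real mat \<Rightarrow> bool" where
  "optimal_solution n p f r X \<longleftrightarrow> feasible_point n p r X \<and>
     (\<forall>Z. feasible_point n p r Z \<longrightarrow> (\<Sum>i<n. f i (row X i)) \<le> (\<Sum>i<n. f i (row Z i)))"

end

theory Submission
  imports Defs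
begin

text \<open>
The optimality conditions are \<open>\<nabla>f\<^sub>i(x\<^sup>*\<^sub>i) = \<nabla>f\<^sub>j(x\<^sup>*\<^sub>j)\<close> for all agents together with
\<open>\<Sum>\<^sub>i x\<^sup>*\<^sub>i = \<Sum>\<^sub>i r\<^sub>i\<close>. In terms of \<open>U\<close>, whose kernel is spanned by the all-ones vector, they say that
\<open>U\<close> annihilates the matrix of gradients and that \<open>r - x\<^sup>* = c U\<^sup>T w\<^sup>*\<close> for some \<open>w\<^sup>*\<close>. Every \<open>y\<^sup>k\<close>
lies in the range of \<open>U\<^sup>T\<close> too. Write \<open>y\<^bsup>k-1\<^esup> = U\<^sup>T (w\<^sup>* + w\<^sup>k)\<close>, and let \<open>e\<^sup>k\<close> and \<open>d\<^sup>k\<close> be the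
deviations of the point and of the gradients from their optimal values. The algorithm becomes
\<open>w\<^bsup>k+1\<^esup> = w\<^sup>k + U d\<^sup>k\<close> and \<open>e\<^bsup>k+1\<^esup> = - c U\<^sup>T (w\<^bsup>k+1\<^esup> + U d\<^sup>k)\<close>.

The quantity \<open>V\<^sup>k = |w\<^bsup>k+1\<^esup>|\<^sup>2 + (3/2) |U d\<^sup>k|\<^sup>2\<close> decreases in each step by at least
\<open>|U d\<^sup>k|\<^sup>2 / 2 + (e\<^bsup>k+1\<^esup> \<bullet> d\<^bsup>k+1\<^esup>) / (4 c)\<close>; this uses that \<open>U\<close> is a contraction, as
\<open>\<lambda>\<^bsub>max\<^esub> \<le> 1\<close>, that gradients are cocoercive, \<open>|d|\<^sup>2 \<le> L (e \<bullet> d)\<close>, and that \<open>2 c L < 1\<close>.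
The decrease is at least the fraction \<open>c \<mu> / (8 \<kappa>\<^sub>L)\<close> of \<open>V\<^sup>k\<close>, because \<open>|w|\<^sup>2 \<le> \<kappa>\<^sub>L |U\<^sup>T w|\<^sup>2\<close> and
\<open>\<mu> |e|\<^sup>2 \<le> e \<bullet> d\<close>; see \<open>lyapunov_step\<close>. So \<open>V\<^sup>k\<close>, and with it the error, decays
geometrically with factor \<open>1 - c L / (8 \<kappa>\<^sub>L \<kappa>\<^sub>f)\<close>, which gives the complexity bound with
\<open>C t = 8 / t\<close>.

The ingredients are the spectral bounds for \<open>U\<close> (\<open>laplacian_spectral_bounds\<close>), obtained from an
attained minimum of the Rayleigh quotient (\<open>minimal_rayleigh_quotient_eigenvector\<close>), the
theorem of Baillon and Haddad (\<open>gradient_cocoercive\<close>), and the first-order conditions at the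
optimum (\<open>optimal_solution_equal_gradients\<close>).
\<close>

section \<open>Smallest eigenvalues of symmetric matrices\<close>

lemma scalar_prod_self_pos:
  assumes "v \<in> carrier_vec n" "v \<noteq> 0\<^sub>v n"
  shows "(v :: real vec) \<bullet> v > 0"
proof -
  have "enorm v \<noteq> 0"
    using enorm_eq_0 assms by blast
  then show ?thesis
    using scalar_prod_self_nonneg[of v] by (auto simp: enorm_def)
qed

lemma quadratic_form_bounded:
  fixes B :: "real mat"
  assumes B: "B \<in> carrier_mat n n"
  obtains K where "K > 0" "\<And>v. v \<in> carrier_vec n \<Longrightarrow> \<bar>v \<bullet> (B *\<^sub>v v)\<bar> \<le> K * (v \<bullet> v)"
proof
  let ?K = "(\<Sum>i<n. \<Sum>j<n. \<bar>B $$ (i, j)\<bar>) + 1"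
  show "?K > 0"
    by (intro add_nonneg_pos sum_nonneg) auto
  fix v :: "real vec" assume v: "v \<in> carrier_vec n"
  have vv: "v \<bullet> v = (\<Sum>i<n. (v $ i)\<^sup>2)"
    using v by (simp add: scalar_prod_def power2_eq_square atLeast0LessThan)
  have entry: "\<bar>v $ i * v $ j\<bar> \<le> v \<bullet> v" if "i < n" "j < n" for i j
  proof -
    have "(v $ i)\<^sup>2 \<le> v \<bullet> v" "(v $ j)\<^sup>2 \<le> v \<bullet> v"
      using that by (auto simp: vv intro!: member_le_sum)
    moreover have "2 * \<bar>v $ i * v $ j\<bar> \<le> (v $ i)\<^sup>2 + (v $ j)\<^sup>2"
      using sum_squares_bound[of "\<bar>v $ i\<bar>" "\<bar>v $ j\<bar>"] by (simp add: abs_mult)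
    ultimately show ?thesis by linarith
  qed
  have "v \<bullet> (B *\<^sub>v v) = (\<Sum>i<n. \<Sum>j<n. B $$ (i, j) * (v $ i * v $ j))"
    using v B by (simp add: scalar_prod_def atLeast0LessThan sum_distrib_left mult_ac)
  also have "\<bar>\<dots>\<bar> \<le> (\<Sum>i<n. \<Sum>j<n. \<bar>B $$ (i, j) * (v $ i * v $ j)\<bar>)"
    by (intro order_trans[OF sum_abs] sum_mono order_refl)
  also have "\<dots> \<le> (\<Sum>i<n. \<Sum>j<n. \<bar>B $$ (i, j)\<bar> * (v \<bullet> v))"
    unfolding abs_mult[of "B $$ _"] using entry by (intro sum_mono mult_left_mono) auto
  also have "\<dots> \<le> ?K * (v \<bullet> v)"
    using scalar_prod_self_nonneg[of v] by (simp add: sum_distrib_right distrib_right)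
  finally show "\<bar>v \<bullet> (B *\<^sub>v v)\<bar> \<le> ?K * (v \<bullet> v)" .
qed

lemma nonsingular_right_inverse:
  fixes B :: "'a::field mat"
  assumes "B \<in> carrier_mat n n" "det B \<noteq> 0"
  obtains C where "C \<in> carrier_mat n n" "B * C = 1\<^sub>m n"
  using det_non_zero_imp_unit[OF assms, of "()"] assms
  unfolding Units_def by (auto simp: ring_mat_simps)

lemma transpose_mult_scalar_prod:
  fixes U :: "real mat"
  assumes U: "U \<in> carrier_mat N n" and v: "v \<in> carrier_vec n" and w: "w \<in> carrier_vec n"
  shows "v \<bullet> ((U\<^sup>T * U) *\<^sub>v w) = (U *\<^sub>v v) \<bullet> (U *\<^sub>v w)"
proof -
  have Uw: "U *\<^sub>v w \<in> carrier_vec N" and Uv: "U *\<^sub>v v \<in> carrier_vec N"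
    using U v w by auto
  have "(U\<^sup>T * U) *\<^sub>v w = U\<^sup>T *\<^sub>v (U *\<^sub>v w)"
    using U w by (intro assoc_mult_mat_vec) auto
  moreover have "U\<^sup>T *\<^sub>v (U *\<^sub>v w) \<in> carrier_vec n"
    using U Uw by auto
  ultimately show ?thesis
    using transpose_vec_mult_scalar[OF U v Uw] comm_scalar_prod[OF v]
      comm_scalar_prod[OF Uv Uw] by auto
qed

text \<open>
A semidefinite form without null vectors is bounded below by algebra alone, with no compactness
argument: if \<open>w\<close> solves \<open>B w = v\<close> and \<open>v \<bullet> w \<le> K (v \<bullet> v)\<close>, then semidefiniteness
at the point \<open>v - w / K\<close> says exactly that \<open>v \<bullet> B v \<ge> (v \<bullet> v) / K\<close>.
\<close>

lemma invertible_semidefinite_coercive: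
  fixes B :: "real mat"
  assumes B: "B \<in> carrier_mat n n" and sym: "B\<^sup>T = B" and det: "det B \<noteq> 0"
    and psd: "\<And>v. v \<in> carrier_vec n \<Longrightarrow> v \<bullet> (B *\<^sub>v v) \<ge> 0"
  obtains \<delta> where "\<delta> > 0" "\<And>v. v \<in> carrier_vec n \<Longrightarrow> v \<bullet> (B *\<^sub>v v) \<ge> \<delta> * (v \<bullet> v)"
proof -
  obtain C where C: "C \<in> carrier_mat n n" and BC: "B * C = 1\<^sub>m n"
    using nonsingular_right_inverse[OF B det] by blast
  obtain K where K: "K > 0" and Kb: "\<And>v. v \<in> carrier_vec n \<Longrightarrow> \<bar>v \<bullet> (C *\<^sub>v v)\<bar> \<le> K * (v \<bullet> v)"
    using quadratic_form_bounded[OF C] by blast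
  have "v \<bullet> (B *\<^sub>v v) \<ge> (1 / K) * (v \<bullet> v)" if v: "v \<in> carrier_vec n" for v
  proof -
    define w where "w = C *\<^sub>v v"
    have w: "w \<in> carrier_vec n"
      using C v by (simp add: w_def)
    have Bw: "B *\<^sub>v w = v"
      unfolding w_def assoc_mult_mat_vec[OF B C v, symmetric] BC using v by simp
    have wBv: "w \<bullet> (B *\<^sub>v v) = v \<bullet> v"
      using transpose_vec_mult_scalar[OF B v w] sym Bw by simp
    have vw: "v \<bullet> w \<le> K * (v \<bullet> v)"
      using Kb[OF v] by (simp add: w_def)
    have Bv: "B *\<^sub>v v \<in> carrier_vec n"
      using B v by simp
    let ?s = "1 / K"
    have "0 \<le> (v - ?s \<cdot>\<^sub>v w) \<bullet> (B *\<^sub>v (v - ?s \<cdot>\<^sub>v w))"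
      using v w by (intro psd) simp
    also have "B *\<^sub>v (v - ?s \<cdot>\<^sub>v w) = B *\<^sub>v v - ?s \<cdot>\<^sub>v v"
      using mult_minus_distrib_mat_vec[OF B v, of "?s \<cdot>\<^sub>v w"] mult_mat_vec[OF B w, of ?s] w Bw by simp
    also have "(v - ?s \<cdot>\<^sub>v w) \<bullet> (B *\<^sub>v v - ?s \<cdot>\<^sub>v v) =
        v \<bullet> (B *\<^sub>v v) - 2 * ?s * (v \<bullet> v) + ?s * ?s * (v \<bullet> w)"
      using v w Bv by (simp add: minus_scalar_prod_distrib[where n = n]
        scalar_prod_minus_distrib[where n = n] wBv comm_scalar_prod[OF w v] algebra_simps)
    also have "\<dots> \<le> v \<bullet> (B *\<^sub>v v) - 2 * ?s * (v \<bullet> v) + ?s * ?s * (K * (v \<bullet> v))"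
      using vw K by (intro add_left_mono mult_left_mono) auto
    finally show ?thesis
      using K by (simp add: field_simps)
  qed
  then show ?thesis
    using that[of "1 / K"] K by simp
qed

text \<open>
Let \<open>\<alpha>\<close> be the infimum of the Rayleigh quotient. The form of \<open>A - \<alpha> 1\<close> is semidefinite; if this
matrix were invertible, its form would be coercive and the quotient would stay above some
\<open>\<alpha> + \<delta>\<close>. So the matrix is singular, and a null vector of it is an eigenvector of \<open>A\<close>.
\<close>

lemma minimal_rayleigh_quotient_eigenvector:
  fixes A :: "real mat"
  assumes A: "A \<in> carrier_mat n n" and sym: "A\<^sup>T = A" and n: "n > 0"
  obtains \<alpha> v where "eigenvector A v \<alpha>" "\<And>w. w \<in> carrier_vec n \<Longrightarrow> w \<bullet> (A *\<^sub>v w) \<ge> \<alpha> * (w \<bullet> w)"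
proof -
  define R where "R = {v \<bullet> (A *\<^sub>v v) / (v \<bullet> v) | v. v \<in> carrier_vec n \<and> v \<noteq> 0\<^sub>v n}"
  obtain K where K: "\<And>v. v \<in> carrier_vec n \<Longrightarrow> \<bar>v \<bullet> (A *\<^sub>v v)\<bar> \<le> K * (v \<bullet> v)"
    using quadratic_form_bounded[OF A] by blast
  have bdd: "bdd_below R"
  proof (rule bdd_belowI[of _ "- K"])
    fix q assume "q \<in> R"
    then obtain v where v: "v \<in> carrier_vec n" "v \<noteq> 0\<^sub>v n" "q = v \<bullet> (A *\<^sub>v v) / (v \<bullet> v)"
      by (auto simp: R_def)
    have "- K * (v \<bullet> v) \<le> q * (v \<bullet> v)"
      using K[of v] scalar_prod_self_pos[of v n] v by (simp add: abs_le_iff)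
    then show "- K \<le> q"
      using scalar_prod_self_pos[of v n] v by (blast intro: mult_right_le_imp_le)
  qed
  have ne: "R \<noteq> {}"
  proof -
    have "unit_vec n 0 \<noteq> (0\<^sub>v n :: real vec)"
      using n by (metis index_unit_vec(2) index_zero_vec(1) zero_neq_one)
    then show ?thesis
      using unit_vec_carrier[of n 0] unfolding R_def by blast
  qed
  define \<alpha> where "\<alpha> = Inf R"
  have low: "w \<bullet> (A *\<^sub>v w) \<ge> \<alpha> * (w \<bullet> w)" if w: "w \<in> carrier_vec n" for w
  proof (cases "w = 0\<^sub>v n")
    case True
    then show ?thesis using A by simp
  next
    case False
    have "\<alpha> \<le> w \<bullet> (A *\<^sub>v w) / (w \<bullet> w)"
      unfolding \<alpha>_def using w False by (intro cInf_lower[OF _ bdd]) (auto simp: R_def)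
    then show ?thesis
      using scalar_prod_self_pos[OF w False] by (simp add: field_simps)
  qed
  define B where "B = A - \<alpha> \<cdot>\<^sub>m 1\<^sub>m n"
  have B: "B \<in> carrier_mat n n"
    unfolding B_def by (intro minus_carrier_mat smult_carrier_mat one_carrier_mat)
  have Bv: "B *\<^sub>v v = A *\<^sub>v v - \<alpha> \<cdot>\<^sub>v v" if v: "v \<in> carrier_vec n" for v
  proof -
    have "(\<alpha> \<cdot>\<^sub>m 1\<^sub>m n) *\<^sub>v v = \<alpha> \<cdot>\<^sub>v v"
      using v by (intro eq_vecI) auto
    then show ?thesis
      using A v by (simp add: B_def minus_mult_distrib_mat_vec[where nr = n and nc = n])
  qed
  have quad: "v \<bullet> (B *\<^sub>v v) = v \<bullet> (A *\<^sub>v v) - \<alpha> * (v \<bullet> v)" if "v \<in> carrier_vec n" for v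
    using A that by (simp add: Bv scalar_prod_minus_distrib[where n = n])
  have "(\<alpha> \<cdot>\<^sub>m 1\<^sub>m n)\<^sup>T = \<alpha> \<cdot>\<^sub>m 1\<^sub>m n"
    by (intro eq_matI) auto
  then have "B\<^sup>T = B"
    using A sym by (simp add: B_def transpose_minus[where nr = n and nc = n])
  have "det B = 0"
  proof (rule ccontr)
    assume "det B \<noteq> 0"
    then obtain \<delta> where \<delta>: "\<delta> > 0" "\<And>v. v \<in> carrier_vec n \<Longrightarrow> v \<bullet> (B *\<^sub>v v) \<ge> \<delta> * (v \<bullet> v)"
      using invertible_semidefinite_coercive[OF B \<open>B\<^sup>T = B\<close>] low quad by (metis diff_ge_0_iff_ge)
    have "\<alpha> + \<delta> \<le> Inf R"
    proof (rule cInf_greatest[OF ne])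
      fix q assume "q \<in> R"
      then obtain v where v: "v \<in> carrier_vec n" "v \<noteq> 0\<^sub>v n" "q = v \<bullet> (A *\<^sub>v v) / (v \<bullet> v)"
        by (auto simp: R_def)
      then have "(\<alpha> + \<delta>) * (v \<bullet> v) \<le> v \<bullet> (A *\<^sub>v v)"
        using \<delta>(2)[of v] quad[of v] by (simp add: algebra_simps)
      then show "\<alpha> + \<delta> \<le> q"
        using v scalar_prod_self_pos[of v n] by (simp add: pos_le_divide_eq)
    qed
    with \<delta> show False by (simp add: \<alpha>_def)
  qed
  then obtain v where v: "v \<in> carrier_vec n" "v \<noteq> 0\<^sub>v n" "B *\<^sub>v v = 0\<^sub>v n"
    using det_0_iff_vec_prod_zero[OF B] by blast
  have "A *\<^sub>v v = \<alpha> \<cdot>\<^sub>v v"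
  proof (rule eq_vecI)
    fix i assume i: "i < dim_vec (\<alpha> \<cdot>\<^sub>v v)"
    with v have "(A *\<^sub>v v - \<alpha> \<cdot>\<^sub>v v) $ i = 0"
      using Bv[OF v(1)] by simp
    then show "(A *\<^sub>v v) $ i = (\<alpha> \<cdot>\<^sub>v v) $ i"
      using i A v by simp
  qed (use A v in auto)
  then have "eigenvector A v \<alpha>"
    using v A by (simp add: eigenvector_def)
  then show ?thesis
    using that low by blast
qed

section \<open>Spectrum and range of a factored Laplacian\<close>

text \<open>
Full row rank makes some \<open>N\<close> columns of \<open>U\<close> an invertible square matrix \<open>B\<close>, and a vector that
\<open>U\<^sup>T\<close> annihilates is orthogonal to all columns of \<open>U\<close>, hence annihilated by \<open>B\<^sup>T\<close>.
\<close>

lemma full_row_rank_transpose_injective: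
  fixes U :: "'a::field mat"
  assumes U: "U \<in> carrier_mat N n" and rank: "vec_space.rank N U = N"
    and v: "v \<in> carrier_vec N" and Uv: "U\<^sup>T *\<^sub>v v = 0\<^sub>v n"
  shows "v = 0\<^sub>v N"
proof -
  interpret vec_space "TYPE('a)" N .
  let ?P = "\<lambda>T. T \<subseteq> set (cols U) \<and> lin_indpt T"
  have "?P {}"
    using lin_dep_def by auto
  then obtain S where S: "finite S" "maximal S ?P"
    using maximal_exists_superset[of "set (cols U)" ?P "{}"] by auto
  then have "card S = N"
    using rank_card_indpt[OF U S(2)] rank by simp
  obtain xs where xs: "set xs = S" "distinct xs"
    using finite_distinct_list[OF S(1)] by blast
  have Ssub: "S \<subseteq> set (cols U)" and li: "lin_indpt S"
    using S(2) by (auto simp: maximal_def)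
  have len: "length xs = N"
    using xs \<open>card S = N\<close> distinct_card by fastforce
  have Sc: "set xs \<subseteq> carrier_vec N"
    using Ssub U xs cols_dim[of U] by auto
  define B where "B = mat_of_cols N xs"
  have B: "B \<in> carrier_mat N N"
    using len by (auto simp: B_def)
  have cols: "cols B = xs"
    unfolding B_def using Sc by (rule cols_mat_of_cols)
  have "det B \<noteq> 0"
    using lin_indpt_full_rank[OF B] cols xs li det_rank_iff[OF B] by simp
  then have det: "det (B\<^sup>T) \<noteq> 0"
    using det_transpose[OF B] by simp
  have "B\<^sup>T *\<^sub>v v = 0\<^sub>v N"
  proof (rule eq_vecI)
    fix i assume "i < dim_vec (0\<^sub>v N :: 'a vec)"
    then have i: "i < N" by simp
    then have "xs ! i \<in> set (cols U)"
      using len xs Ssub nth_mem by blast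
    then obtain j where j: "j < n" "xs ! i = col U j"
      using U by (auto simp: cols_def)
    have "(U\<^sup>T *\<^sub>v v) $ j = 0"
      using Uv j by simp
    then have "col U j \<bullet> v = 0"
      using U j by simp
    moreover have "col B i = xs ! i"
      using cols cols_nth[of i B] i B by simp
    ultimately show "(B\<^sup>T *\<^sub>v v) $ i = 0\<^sub>v N $ i"
      using B i j by simp
  qed (use B in auto)
  then show ?thesis
    using det det_0_iff_vec_prod_zero[of "B\<^sup>T" N] B v by auto
qed

text \<open>
The two inequalities that the convergence proof takes from the spectrum. The transpose \<open>U\<^sup>T\<close> is
injective and maps an eigenvector of the Gram matrix \<open>U U\<^sup>T\<close> to one of \<open>U\<^sup>T U\<close> for the same
eigenvalue; so the smallest eigenvalue of the Gram matrix is positive and no smaller than the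
smallest nonzero eigenvalue of the Laplacian, which gives the expansion bound. The contraction bound
is the minimal Rayleigh quotient of the negated Laplacian.
\<close>

lemma laplacian_spectral_bounds:
  assumes n: "n \<ge> 2" and U: "laplacian_factor n U" and top: "lambda_max (U\<^sup>T * U) \<le> 1"
  shows lambda_min_nonzero_pos: "0 < lambda_min_nonzero (U\<^sup>T * U)"
    and lambda_min_nonzero_le_1: "lambda_min_nonzero (U\<^sup>T * U) \<le> 1"
    and laplacian_factor_contraction:
      "\<And>v. v \<in> carrier_vec n \<Longrightarrow> (U *\<^sub>v v) \<bullet> (U *\<^sub>v v) \<le> v \<bullet> v"
    and transpose_laplacian_factor_expansion:
      "\<And>w. w \<in> carrier_vec (n - 1) \<Longrightarrow>
        lambda_min_nonzero (U\<^sup>T * U) * (w \<bullet> w) \<le> (U\<^sup>T *\<^sub>v w) \<bullet> (U\<^sup>T *\<^sub>v w)"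
proof -
  define N where "N = n - 1"
  have N: "N > 0" using n by (simp add: N_def)
  have Uc: "U \<in> carrier_mat N n" and rank: "vec_space.rank N U = N"
    using U by (auto simp: laplacian_factor_def N_def)
  have Ut: "U\<^sup>T \<in> carrier_mat n N" using Uc by simp
  let ?Lap = "U\<^sup>T * U" and ?Gram = "U * U\<^sup>T"
  let ?l = "lambda_min_nonzero ?Lap"
  have Lap: "?Lap \<in> carrier_mat n n" and Gram: "?Gram \<in> carrier_mat N N"
    using Uc by auto
  have Lap_sym: "?Lap\<^sup>T = ?Lap" and Gram_sym: "?Gram\<^sup>T = ?Gram"
    using transpose_mult[OF Ut Uc] transpose_mult[OF Uc Ut] by auto
  have gram: "w \<bullet> (?Gram *\<^sub>v w) = (U\<^sup>T *\<^sub>v w) \<bullet> (U\<^sup>T *\<^sub>v w)" if "w \<in> carrier_vec N" for w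
    using transpose_mult_scalar_prod[OF Ut that that] by simp
  have fin: "finite (spectrum ?Lap)"
    using card_finite_spectrum[OF Lap] by simp
  obtain b v where bv: "eigenvector ?Gram v b"
    and b: "\<And>w. w \<in> carrier_vec N \<Longrightarrow> w \<bullet> (?Gram *\<^sub>v w) \<ge> b * (w \<bullet> w)"
    using minimal_rayleigh_quotient_eigenvector[OF Gram Gram_sym N] by blast
  have v: "v \<in> carrier_vec N" "v \<noteq> 0\<^sub>v N" "?Gram *\<^sub>v v = b \<cdot>\<^sub>v v"
    using bv Uc by (auto simp: eigenvector_def)
  define u where "u = U\<^sup>T *\<^sub>v v"
  have u: "u \<in> carrier_vec n" using Ut v by (simp add: u_def)
  have u0: "u \<noteq> 0\<^sub>v n"
    using full_row_rank_transpose_injective[OF Uc rank v(1)] v(2) by (auto simp: u_def)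
  have "b * (v \<bullet> v) = u \<bullet> u"
    using gram[OF v(1)] v by (simp add: u_def)
  then have bpos: "b > 0"
    using scalar_prod_self_pos[OF u u0] scalar_prod_self_nonneg[of v]
    by (metis mult_nonpos_nonneg not_le)
  have "?Lap *\<^sub>v u = U\<^sup>T *\<^sub>v (?Gram *\<^sub>v v)"
    using Uc Ut v u by (simp add: u_def)
  also have "\<dots> = b \<cdot>\<^sub>v u"
    unfolding v(3) u_def by (rule mult_mat_vec[OF Ut v(1)])
  finally have "b \<in> spectrum ?Lap - {0}"
    using u u0 bpos Uc by (auto simp: spectrum_def eigenvalue_def eigenvector_def)
  then have mem: "?l \<in> spectrum ?Lap - {0}" and lb: "?l \<le> b"
    unfolding lambda_min_nonzero_def using fin Min_in[of "spectrum ?Lap - {0}"]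
    by (blast, simp)
  show "?l \<le> 1"
    using Max_ge[OF fin, of ?l] mem top by (auto simp: lambda_max_def)
  obtain x where x: "x \<in> carrier_vec n" "x \<noteq> 0\<^sub>v n" "?Lap *\<^sub>v x = ?l \<cdot>\<^sub>v x"
    using mem Uc by (auto simp: spectrum_def eigenvalue_def eigenvector_def)
  have "?l * (x \<bullet> x) = (U *\<^sub>v x) \<bullet> (U *\<^sub>v x)"
    using transpose_mult_scalar_prod[OF Uc x(1) x(1)] x by simp
  then have "?l * (x \<bullet> x) \<ge> 0"
    by (simp add: scalar_prod_self_nonneg)
  then show "0 < ?l"
    using scalar_prod_self_pos[OF x(1,2)] mem by (auto simp: zero_le_mult_iff)
  show "?l * (w \<bullet> w) \<le> (U\<^sup>T *\<^sub>v w) \<bullet> (U\<^sup>T *\<^sub>v w)" if "w \<in> carrier_vec (n - 1)" for w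
  proof -
    have w: "w \<in> carrier_vec N" using that by (simp add: N_def)
    have "?l * (w \<bullet> w) \<le> b * (w \<bullet> w)"
      using lb scalar_prod_self_nonneg by (rule mult_right_mono)
    then show ?thesis
      using b[OF w] gram[OF w] by simp
  qed
  have nLap: "- ?Lap \<in> carrier_mat n n" using Lap by simp
  have nsym: "(- ?Lap)\<^sup>T = - ?Lap" using Lap_sym by (simp add: transpose_uminus)
  obtain a z where az: "eigenvector (- ?Lap) z a"
    and a: "\<And>w. w \<in> carrier_vec n \<Longrightarrow> w \<bullet> (- ?Lap *\<^sub>v w) \<ge> a * (w \<bullet> w)"
    using minimal_rayleigh_quotient_eigenvector[OF nLap nsym less_le_trans[OF pos2 n]] by blast
  have neg: "- ?Lap *\<^sub>v w = - (?Lap *\<^sub>v w)" if "w \<in> carrier_vec n" for w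
    using Uc that by (intro uminus_mult_mat_vec) auto
  have z: "z \<in> carrier_vec n" "z \<noteq> 0\<^sub>v n" "- (?Lap *\<^sub>v z) = a \<cdot>\<^sub>v z"
    using az Uc neg by (auto simp: eigenvector_def)
  have "?Lap *\<^sub>v z = - (- (?Lap *\<^sub>v z))"
    by simp
  also have "\<dots> = (- a) \<cdot>\<^sub>v z"
    unfolding z(3) using z by (intro eq_vecI) auto
  finally have "- a \<in> spectrum ?Lap"
    using z Uc by (auto simp: spectrum_def eigenvalue_def eigenvector_def)
  then have a1: "- a \<le> 1"
    using Max_ge[OF fin] top unfolding lambda_max_def by (meson order_trans)
  show "(U *\<^sub>v w) \<bullet> (U *\<^sub>v w) \<le> w \<bullet> w" if w: "w \<in> carrier_vec n" for w
  proof -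
    have "w \<bullet> (- ?Lap *\<^sub>v w) = - ((U *\<^sub>v w) \<bullet> (U *\<^sub>v w))"
      unfolding neg[OF w] using transpose_mult_scalar_prod[OF Uc w w] w Uc
      by (subst scalar_prod_uminus_right) auto
    then have "(U *\<^sub>v w) \<bullet> (U *\<^sub>v w) \<le> (- a) * (w \<bullet> w)"
      using a[OF w] by simp
    also have "\<dots> \<le> 1 * (w \<bullet> w)"
      using a1 scalar_prod_self_nonneg by (rule mult_right_mono)
    finally show ?thesis by simp
  qed
qed

text \<open>
The range of \<open>U\<^sup>T\<close> is the orthogonal complement of the kernel of \<open>U\<close>. If \<open>u\<close> solves the normal
equation \<open>U U\<^sup>T u = U b\<close>, the remainder \<open>b - U\<^sup>T u\<close> lies in the kernel, so it is a constant
vector; its entries sum to zero, so it vanishes.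
\<close>

lemma laplacian_factor_transpose_range:
  assumes n: "n > 0" and U: "laplacian_factor n U"
    and b: "b \<in> carrier_vec n" and sum0: "(\<Sum>i<n. b $ i) = 0"
  obtains u where "u \<in> carrier_vec (n - 1)" "U\<^sup>T *\<^sub>v u = b"
proof -
  define N where "N = n - 1"
  have Uc: "U \<in> carrier_mat N n" and rank: "vec_space.rank N U = N"
    and ker: "mat_kernel U = {a \<cdot>\<^sub>v vec n (\<lambda>_. 1) | a. True}"
    using U by (auto simp: laplacian_factor_def N_def)
  have Ut: "U\<^sup>T \<in> carrier_mat n N" using Uc by simp
  let ?Gram = "U * U\<^sup>T" and ?one = "vec n (\<lambda>_. 1) :: real vec"
  have Gram: "?Gram \<in> carrier_mat N N" using Uc by simp
  have "det ?Gram \<noteq> 0"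
  proof
    assume "det ?Gram = 0"
    then obtain v where v: "v \<in> carrier_vec N" "v \<noteq> 0\<^sub>v N" "?Gram *\<^sub>v v = 0\<^sub>v N"
      using det_0_iff_vec_prod_zero[OF Gram] by blast
    have "(U\<^sup>T *\<^sub>v v) \<bullet> (U\<^sup>T *\<^sub>v v) = 0"
      using transpose_mult_scalar_prod[OF Ut v(1) v(1)] v by simp
    then have "U\<^sup>T *\<^sub>v v = 0\<^sub>v n"
      using scalar_prod_self_pos[of "U\<^sup>T *\<^sub>v v" n] Ut v by force
    then show False
      using full_row_rank_transpose_injective[OF Uc rank v(1)] v(2) by blast
  qed
  then obtain C where C: "C \<in> carrier_mat N N" and GC: "?Gram * C = 1\<^sub>m N"
    using nonsingular_right_inverse[OF Gram] by blast
  define u where "u = C *\<^sub>v (U *\<^sub>v b)"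
  define z where "z = b - U\<^sup>T *\<^sub>v u"
  have Ub: "U *\<^sub>v b \<in> carrier_vec N" using Uc b by simp
  have u: "u \<in> carrier_vec N" using C Ub by (simp add: u_def)
  have Uu: "U\<^sup>T *\<^sub>v u \<in> carrier_vec n" using Ut u by simp
  have z: "z \<in> carrier_vec n" using b Uu by (simp add: z_def)
  have "U *\<^sub>v (U\<^sup>T *\<^sub>v u) = ?Gram *\<^sub>v u"
    using assoc_mult_mat_vec[OF Uc Ut u] by simp
  also have "\<dots> = (?Gram * C) *\<^sub>v (U *\<^sub>v b)"
    unfolding u_def using assoc_mult_mat_vec[OF Gram C Ub] by simp
  also have "\<dots> = U *\<^sub>v b"
    unfolding GC using Ub by simp
  finally have "U *\<^sub>v z = 0\<^sub>v N"
    unfolding z_def using mult_minus_distrib_mat_vec[OF Uc b Uu] Ub by simp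
  then obtain a where za: "z = a \<cdot>\<^sub>v ?one"
    using ker mat_kernelI[OF Uc z] by auto
  have "1 \<cdot>\<^sub>v ?one \<in> mat_kernel U"
    unfolding ker by blast
  then have U1: "U *\<^sub>v ?one = 0\<^sub>v N"
    using mat_kernelD[OF Uc] by simp
  have "(U\<^sup>T *\<^sub>v u) \<bullet> ?one = u \<bullet> (U *\<^sub>v ?one)"
    using transpose_vec_mult_scalar[OF Uc _ u, of ?one] by simp
  also have "\<dots> = 0" using U1 u by simp
  finally have "z \<bullet> ?one = 0"
    using minus_scalar_prod_distrib[OF b Uu, of ?one] sum0 b
    by (simp add: z_def scalar_prod_def atLeast0LessThan)
  then have "a = 0"
    using n by (simp add: za scalar_prod_def)
  then have "z = 0\<^sub>v n"
    using za by auto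
  have "U\<^sup>T *\<^sub>v u = b"
  proof (rule eq_vecI)
    fix i assume "i < dim_vec b"
    then show "(U\<^sup>T *\<^sub>v u) $ i = b $ i"
      using \<open>z = 0\<^sub>v n\<close> b Uu unfolding z_def
      by (metis carrier_vecD eq_iff_diff_eq_0 index_minus_vec(1) index_zero_vec(1))
  qed (use Uc b in auto)
  then show ?thesis
    using that u by (simp add: N_def)
qed

lemma laplacian_factor_transpose_range_mat:
  assumes n: "n > 0" and U: "laplacian_factor n U"
    and B: "B \<in> carrier_mat n p" and sum0: "\<And>l. l < p \<Longrightarrow> (\<Sum>i<n. B $$ (i, l)) = 0"
  obtains W where "W \<in> carrier_mat (n - 1) p" "U\<^sup>T * W = B"
proof -
  have Ut: "U\<^sup>T \<in> carrier_mat n (n - 1)"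
    using U by (simp add: laplacian_factor_def)
  have "\<exists>u. u \<in> carrier_vec (n - 1) \<and> U\<^sup>T *\<^sub>v u = col B l" if l: "l < p" for l
  proof -
    have "col B l \<in> carrier_vec n" "(\<Sum>i<n. col B l $ i) = 0"
      using B l sum0[OF l] by auto
    then show ?thesis
      using laplacian_factor_transpose_range[OF n U] by blast
  qed
  then have "\<forall>l\<in>{..<p}. \<exists>u. u \<in> carrier_vec (n - 1) \<and> U\<^sup>T *\<^sub>v u = col B l"
    by blast
  from bchoice[OF this] obtain u where u: "\<And>l. l < p \<Longrightarrow> u l \<in> carrier_vec (n - 1)"
    "\<And>l. l < p \<Longrightarrow> U\<^sup>T *\<^sub>v u l = col B l"
    by blast
  define W where "W = mat (n - 1) p (\<lambda>(i, l). u l $ i)"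
  have W: "W \<in> carrier_mat (n - 1) p" by (simp add: W_def)
  have colW: "col W l = u l" if "l < p" for l
    using u(1)[OF that] that by (intro eq_vecI) (auto simp: W_def)
  have "U\<^sup>T * W = B"
  proof (rule eq_matI)
    fix i l assume "i < dim_row B" "l < dim_col B"
    then have il: "i < n" "l < p" using B by auto
    then have "(U\<^sup>T * W) $$ (i, l) = (U\<^sup>T *\<^sub>v u l) $ i"
      using Ut W colW by simp
    then show "(U\<^sup>T * W) $$ (i, l) = B $$ (i, l)"
      using u(2) il B by simp
  qed (use Ut W B in auto)
  with W show ?thesis by (rule that)
qed

lemma laplacian_factor_constant_columns:
  assumes U: "laplacian_factor n U" and B: "B \<in> carrier_mat n p"
    and const: "\<And>i j l. i < n \<Longrightarrow> j < n \<Longrightarrow> l < p \<Longrightarrow> B $$ (i, l) = B $$ (j, l)"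
  shows "U * B = 0\<^sub>m (n - 1) p"
proof (rule eq_matI)
  have Uc: "U \<in> carrier_mat (n - 1) n"
    and ker: "mat_kernel U = {a \<cdot>\<^sub>v vec n (\<lambda>_. 1) | a. True}"
    using U by (auto simp: laplacian_factor_def)
  fix i l assume "i < dim_row (0\<^sub>m (n - 1) p :: real mat)" "l < dim_col (0\<^sub>m (n - 1) p :: real mat)"
  then have il: "i < n - 1" "l < p" by auto
  have "col B l = B $$ (0, l) \<cdot>\<^sub>v vec n (\<lambda>_. 1)"
  proof (rule eq_vecI)
    fix j assume "j < dim_vec (B $$ (0, l) \<cdot>\<^sub>v vec n (\<lambda>_. 1 :: real))"
    then have j: "j < n" by simp
    then show "col B l $ j = (B $$ (0, l) \<cdot>\<^sub>v vec n (\<lambda>_. 1)) $ j"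
      using const[of j 0 l] B il by (cases "j = 0") auto
  qed (use B in auto)
  then have "U *\<^sub>v col B l = 0\<^sub>v (n - 1)"
    using ker mat_kernelD(2)[OF Uc] by blast
  then have "(U *\<^sub>v col B l) $ i = 0"
    using il by simp
  then show "(U * B) $$ (i, l) = 0\<^sub>m (n - 1) p $$ (i, l)"
    using Uc B il by simp
qed (use assms in \<open>auto simp: laplacian_factor_def\<close>)

section \<open>Cocoercivity of gradients of smooth convex functions\<close>

lemma enorm_nonneg: "enorm v \<ge> 0"
  by (simp add: enorm_def scalar_prod_self_nonneg)

lemma scalar_prod_le_enorm:
  assumes u: "u \<in> carrier_vec n" and v: "v \<in> carrier_vec n"
  shows "u \<bullet> v \<le> enorm u * enorm v"
proof (cases "enorm u = 0 \<or> enorm v = 0")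
  case True
  then show ?thesis
    using enorm_eq_0[OF u] enorm_eq_0[OF v] u v enorm_nonneg by fastforce
next
  case False
  let ?a = "enorm u" and ?b = "enorm v"
  have pos: "?a > 0" "?b > 0"
    using False enorm_nonneg[of u] enorm_nonneg[of v] by auto
  have "0 \<le> (?b \<cdot>\<^sub>v u - ?a \<cdot>\<^sub>v v) \<bullet> (?b \<cdot>\<^sub>v u - ?a \<cdot>\<^sub>v v)"
    by (rule scalar_prod_self_nonneg)
  also have "\<dots> = ?b\<^sup>2 * (u \<bullet> u) - 2 * ?a * ?b * (u \<bullet> v) + ?a\<^sup>2 * (v \<bullet> v)"
    using u v by (simp add: minus_scalar_prod_distrib[where n = n] scalar_prod_minus_distrib[where n = n]
        comm_scalar_prod[OF v u] power2_eq_square algebra_simps)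
  also have "\<dots> = 2 * (?a * ?b) * (?a * ?b - u \<bullet> v)"
    by (simp add: enorm_square[symmetric] power2_eq_square algebra_simps)
  finally show ?thesis
    using mult_pos_pos[OF pos] by (simp add: zero_le_mult_iff)
qed

lemma has_gradient_gradient:
  assumes "differentiable_fun p f" "x \<in> carrier_vec p"
  shows "has_gradient p f x (gradient p f x)"
  using assms gradient_eq unfolding differentiable_fun_def by blast

lemma gradient_carrier:
  assumes "differentiable_fun p f" "x \<in> carrier_vec p"
  shows "gradient p f x \<in> carrier_vec p"
  using has_gradient_gradient[OF assms] by (simp add: has_gradient_def)

text \<open>
Restriction to a line is what makes the one-variable mean value theorems available for functions on
\<^term>\<open>carrier_vec p\<close>.
\<close>

lemma has_gradient_directional_derivative:
  assumes x: "x \<in> carrier_vec p" and v: "v \<in> carrier_vec p"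
    and g: "has_gradient p f (x + t \<cdot>\<^sub>v v) g"
  shows "((\<lambda>s. f (x + s \<cdot>\<^sub>v v)) has_real_derivative g \<bullet> v) (at t)"
  unfolding DERIV_def LIM_eq
proof (intro allI impI)
  fix e :: real assume e: "e > 0"
  have gc: "g \<in> carrier_vec p"
    using g by (simp add: has_gradient_def)
  define N where "N = enorm v + 1"
  have N: "N > 0" "enorm v < N"
    using enorm_nonneg[of v] by (auto simp: N_def)
  have "e / N > 0" using e N by simp
  then obtain d where d: "d > 0" and
    bd: "\<And>y. y \<in> carrier_vec p \<Longrightarrow> enorm (y - (x + t \<cdot>\<^sub>v v)) < d \<Longrightarrow>
      \<bar>f y - f (x + t \<cdot>\<^sub>v v) - g \<bullet> (y - (x + t \<cdot>\<^sub>v v))\<bar> \<le> e / N * enorm (y - (x + t \<cdot>\<^sub>v v))"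
    using g unfolding has_gradient_def by blast
  show "\<exists>s>0. \<forall>h. h \<noteq> 0 \<and> norm (h - 0) < s \<longrightarrow>
      norm ((f (x + (t + h) \<cdot>\<^sub>v v) - f (x + t \<cdot>\<^sub>v v)) / h - g \<bullet> v) < e"
  proof (intro exI[of _ "d / N"] conjI allI impI)
    show "d / N > 0" using d N by simp
    fix h :: real assume h: "h \<noteq> 0 \<and> norm (h - 0) < d / N"
    let ?y = "x + (t + h) \<cdot>\<^sub>v v"
    have yd: "?y - (x + t \<cdot>\<^sub>v v) = h \<cdot>\<^sub>v v"
      using x v by (intro eq_vecI) (auto simp: algebra_simps)
    have "\<bar>h\<bar> * enorm v \<le> \<bar>h\<bar> * N"
      using N by (intro mult_left_mono) auto
    also have "\<dots> < d"
      using h N by (simp add: field_simps)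
    finally have "\<bar>f ?y - f (x + t \<cdot>\<^sub>v v) - g \<bullet> (h \<cdot>\<^sub>v v)\<bar> \<le> e / N * (\<bar>h\<bar> * enorm v)"
      using bd[of ?y] x v by (simp add: yd enorm_smult)
    moreover have "e / N * (\<bar>h\<bar> * enorm v) < e * \<bar>h\<bar>"
      using e h N by (simp add: field_simps)
    moreover have "g \<bullet> (h \<cdot>\<^sub>v v) = h * (g \<bullet> v)"
      using gc v by simp
    ultimately have "\<bar>f ?y - f (x + t \<cdot>\<^sub>v v) - h * (g \<bullet> v)\<bar> < e * \<bar>h\<bar>"
      by simp
    moreover have "(f ?y - f (x + t \<cdot>\<^sub>v v)) / h - g \<bullet> v
        = (f ?y - f (x + t \<cdot>\<^sub>v v) - h * (g \<bullet> v)) / h"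
      using h by (simp add: field_simps)
    ultimately show "norm ((f ?y - f (x + t \<cdot>\<^sub>v v)) / h - g \<bullet> v) < e"
      using h by (simp add: divide_less_eq)
  qed
qed

lemma line_derivative:
  assumes "differentiable_fun p f" "x \<in> carrier_vec p" "v \<in> carrier_vec p"
  shows "((\<lambda>s. f (x + s \<cdot>\<^sub>v v)) has_real_derivative gradient p f (x + t \<cdot>\<^sub>v v) \<bullet> v) (at t)"
proof -
  have "x + t \<cdot>\<^sub>v v \<in> carrier_vec p"
    using assms by simp
  then show ?thesis
    using has_gradient_directional_derivative has_gradient_gradient assms by blast
qed

text \<open>
Along the segment from \<open>x\<close> to \<open>x + v\<close>, the gap between \<open>f\<close> and the quadratic upper model has
derivative at most zero, by Cauchy-Schwarz and the Lipschitz condition.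
\<close>

lemma descent_inequality:
  assumes f: "differentiable_fun p f" and lip: "lipschitz_gradient p f K"
    and x: "x \<in> carrier_vec p" and v: "v \<in> carrier_vec p"
  shows "f (x + v) \<le> f x + gradient p f x \<bullet> v + K / 2 * (v \<bullet> v)"
proof -
  let ?g = "gradient p f"
  define h where "h t = f (x + t \<cdot>\<^sub>v v) - t * (?g x \<bullet> v) - K / 2 * t\<^sup>2 * (v \<bullet> v)" for t
  have "h 1 \<le> h 0"
  proof (rule DERIV_nonpos_imp_nonincreasing[where f = h and a = 0 and b = 1])
    show "(0::real) \<le> 1" by simp
    fix t :: real assume t: "0 \<le> t" "t \<le> 1"
    let ?xt = "x + t \<cdot>\<^sub>v v"
    have xt: "?xt \<in> carrier_vec p" using x v by simp
    have D: "(h has_real_derivative ?g ?xt \<bullet> v - ?g x \<bullet> v - K * t * (v \<bullet> v)) (at t)"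
      unfolding h_def[abs_def]
      by (rule DERIV_diff line_derivative[OF f x v] | (auto intro!: derivative_eq_intros)[])+
    have diff: "?xt - x = t \<cdot>\<^sub>v v"
      using x v by (intro eq_vecI) auto
    have gc: "?g ?xt \<in> carrier_vec p" "?g x \<in> carrier_vec p"
      using gradient_carrier[OF f] x xt by auto
    have "?g ?xt \<bullet> v - ?g x \<bullet> v = (?g ?xt - ?g x) \<bullet> v"
      using gc v by (simp add: minus_scalar_prod_distrib[where n = p])
    also have "\<dots> \<le> enorm (?g ?xt - ?g x) * enorm v"
      using gc v by (intro scalar_prod_le_enorm[where n = p]) auto
    also have "\<dots> \<le> K * enorm (?xt - x) * enorm v"
      using lip x xt enorm_nonneg[of v] by (intro mult_right_mono) (auto simp: lipschitz_gradient_def)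
    also have "\<dots> = K * t * (v \<bullet> v)"
      using t by (simp add: diff enorm_smult enorm_square[symmetric] power2_eq_square)
    finally show "\<exists>y. (h has_real_derivative y) (at t) \<and> y \<le> 0"
      using D by auto
  qed
  moreover have "x + 0 \<cdot>\<^sub>v v = x" "x + 1 \<cdot>\<^sub>v v = x + v"
    using x v by (auto intro!: eq_vecI)
  ultimately show ?thesis
    by (simp add: h_def)
qed

lemma first_order_convexity:
  assumes f: "differentiable_fun p f" and m: "m \<ge> 0" and cvx: "strongly_convex p f m"
    and x: "x \<in> carrier_vec p" and v: "v \<in> carrier_vec p"
  shows "f x + gradient p f x \<bullet> v \<le> f (x + v)"
proof -
  let ?g = "gradient p f"
  define h where "h t = f (x + t \<cdot>\<^sub>v v) - t * (?g x \<bullet> v)" for t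
  have "h 0 \<le> h 1"
  proof (rule DERIV_nonneg_imp_nondecreasing[where f = h and a = 0 and b = 1])
    show "(0::real) \<le> 1" by simp
    fix t :: real assume t: "0 \<le> t" "t \<le> 1"
    let ?xt = "x + t \<cdot>\<^sub>v v"
    have xt: "?xt \<in> carrier_vec p" using x v by simp
    have D: "(h has_real_derivative ?g ?xt \<bullet> v - ?g x \<bullet> v) (at t)"
      unfolding h_def[abs_def]
      by (rule DERIV_diff line_derivative[OF f x v] | (auto intro!: derivative_eq_intros)[])+
    have gc: "?g ?xt \<in> carrier_vec p" "?g x \<in> carrier_vec p"
      using gradient_carrier[OF f] x xt by auto
    have eq: "?g ?xt \<bullet> v - ?g x \<bullet> v = (?g ?xt - ?g x) \<bullet> v"
      using gc v by (simp add: minus_scalar_prod_distrib[where n = p])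
    have "?g ?xt \<bullet> v - ?g x \<bullet> v \<ge> 0"
    proof (cases "t = 0")
      case True
      moreover have "x + 0 \<cdot>\<^sub>v v = x"
        using x v by (auto intro!: eq_vecI)
      ultimately show ?thesis by simp
    next
      case False
      have diff: "?xt - x = t \<cdot>\<^sub>v v"
        using x v by (intro eq_vecI) auto
      have "0 \<le> m * (enorm (?xt - x))\<^sup>2"
        using m by simp
      also have "\<dots> \<le> (?g ?xt - ?g x) \<bullet> (?xt - x)"
        using cvx x xt by (simp add: strongly_convex_def)
      also have "\<dots> = t * ((?g ?xt - ?g x) \<bullet> v)"
        using gc v by (simp add: diff)
      finally show ?thesis
        using t False eq by (simp add: zero_le_mult_iff)
    qed
    then show "\<exists>y. (h has_real_derivative y) (at t) \<and> 0 \<le> y"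
      using D by auto
  qed
  moreover have "x + 0 \<cdot>\<^sub>v v = x" "x + 1 \<cdot>\<^sub>v v = x + v"
    using x v by (auto intro!: eq_vecI)
  ultimately show ?thesis
    by (simp add: h_def)
qed

text \<open>
Compare two estimates of \<open>f\<close> at the point reached from \<open>x\<close> by the step \<open>- d / K\<close>, which minimizes the
quadratic upper model of \<open>f - \<nabla>f(y) \<bullet> _\<close> at \<open>x\<close>: the descent inequality from \<open>x\<close> bounds the
value above, the tangent at \<open>y\<close> bounds it below.
\<close>

lemma bregman_lower_bound:
  assumes f: "differentiable_fun p f" and lip: "lipschitz_gradient p f K" and K: "K > 0"
    and m: "m \<ge> 0" and cvx: "strongly_convex p f m"
    and x: "x \<in> carrier_vec p" and y: "y \<in> carrier_vec p"
  defines "d \<equiv> gradient p f x - gradient p f y"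
  shows "f y + gradient p f y \<bullet> (x - y) + 1 / (2 * K) * (d \<bullet> d) \<le> f x"
proof -
  let ?g = "gradient p f"
  have gc: "?g x \<in> carrier_vec p" "?g y \<in> carrier_vec p"
    using gradient_carrier[OF f] x y by auto
  then have d: "d \<in> carrier_vec p" by (simp add: d_def)
  define s where "s = (- 1 / K) \<cdot>\<^sub>v d"
  have s: "s \<in> carrier_vec p" using d by (simp add: s_def)
  have z: "y + (x - y + s) = x + s"
    using x y s by (intro eq_vecI) auto
  have "f (x + s) \<le> f x + ?g x \<bullet> s + K / 2 * (s \<bullet> s)"
    by (rule descent_inequality[OF f lip x s])
  moreover have "f y + ?g y \<bullet> (x - y + s) \<le> f (x + s)"
    using first_order_convexity[OF f m cvx y, of "x - y + s"] x y s by (simp add: z)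
  moreover have "?g y \<bullet> (x - y + s) = ?g y \<bullet> (x - y) + ?g y \<bullet> s"
    using gc x y s by (simp add: scalar_prod_add_distrib[where n = p])
  moreover have "?g x \<bullet> s - ?g y \<bullet> s = (- 1 / K) * (d \<bullet> d)"
  proof -
    have "?g x \<bullet> s - ?g y \<bullet> s = d \<bullet> s"
      unfolding d_def using gc s by (simp add: minus_scalar_prod_distrib[where n = p])
    then show ?thesis using d by (simp add: s_def)
  qed
  moreover have "K / 2 * (s \<bullet> s) = 1 / (2 * K) * (d \<bullet> d)"
    using d K by (simp add: s_def field_simps)
  moreover have "(- 1 / K) * (d \<bullet> d) + 1 / (2 * K) * (d \<bullet> d) = - (1 / (2 * K) * (d \<bullet> d))"
    using K by (simp add: field_simps)
  ultimately show ?thesis by linarith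
qed

text \<open>
The theorem of Baillon and Haddad: add the Bregman bounds for the pairs \<open>(x, y)\<close> and \<open>(y, x)\<close>;
the function values cancel.
\<close>

lemma gradient_cocoercive:
  assumes f: "differentiable_fun p f" and lip: "lipschitz_gradient p f K" and K: "K > 0"
    and m: "m \<ge> 0" and cvx: "strongly_convex p f m"
    and x: "x \<in> carrier_vec p" and y: "y \<in> carrier_vec p"
  defines "d \<equiv> gradient p f x - gradient p f y"
  shows "d \<bullet> d \<le> K * (d \<bullet> (x - y))"
proof -
  let ?g = "gradient p f"
  have gc: "?g x \<in> carrier_vec p" "?g y \<in> carrier_vec p"
    using gradient_carrier[OF f] x y by auto
  have swap: "(?g y - ?g x) \<bullet> (?g y - ?g x) = d \<bullet> d" "?g x \<bullet> (y - x) = - (?g x \<bullet> (x - y))"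
    using gc x y by (auto simp: d_def scalar_prod_def simp flip: sum_negf intro!: sum.cong)
      (auto simp: algebra_simps)
  have "d \<bullet> (x - y) = ?g x \<bullet> (x - y) - ?g y \<bullet> (x - y)"
    unfolding d_def using gc x y by (intro minus_scalar_prod_distrib[where n = p]) auto
  moreover have "f y + ?g y \<bullet> (x - y) + 1 / (2 * K) * (d \<bullet> d) \<le> f x"
    unfolding d_def by (rule bregman_lower_bound[OF f lip K m cvx x y])
  moreover have "f x - ?g x \<bullet> (x - y) + 1 / (2 * K) * (d \<bullet> d) \<le> f y"
    using bregman_lower_bound[OF f lip K m cvx y x] swap by simp
  moreover have "2 * (1 / (2 * K) * (d \<bullet> d)) = (d \<bullet> d) / K"
    by simp
  ultimately have "(d \<bullet> d) / K \<le> d \<bullet> (x - y)"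
    by linarith
  then show ?thesis
    using K by (simp add: field_simps)
qed

text \<open>
Two distinct points exist because \<open>p > 0\<close>. This is the source of positivity of the Lipschitz
constants and of \<open>\<kappa>\<^sub>f \<ge> 1\<close>.
\<close>

lemma lipschitz_constant_ge_convexity_modulus:
  assumes p: "p > 0" and f: "differentiable_fun p f" and lip: "lipschitz_gradient p f K"
    and cvx: "strongly_convex p f m"
  shows "m \<le> K"
proof -
  let ?g = "gradient p f"
  let ?x = "unit_vec p 0 :: real vec" and ?y = "0\<^sub>v p :: real vec"
  have xy: "?x \<in> carrier_vec p" "?y \<in> carrier_vec p" by auto
  have "enorm (?x - ?y) = 1"
    using p by (simp add: enorm_def)
  moreover have "?g ?x - ?g ?y \<in> carrier_vec p"
    using gradient_carrier[OF f] xy by simp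
  ultimately have "(?g ?x - ?g ?y) \<bullet> (?x - ?y) \<le> enorm (?g ?x - ?g ?y)"
    using scalar_prod_le_enorm[of "?g ?x - ?g ?y" p "?x - ?y"] by simp
  also have "\<dots> \<le> K * enorm (?x - ?y)"
    using lip xy unfolding lipschitz_gradient_def by blast
  finally show ?thesis
    using cvx xy \<open>enorm (?x - ?y) = 1\<close> unfolding strongly_convex_def
    by (metis mult.right_neutral one_power2 order_trans)
qed

section \<open>The Frobenius inner product\<close>

text \<open>
Summation by columns matches the action of \<open>U\<close>, which multiplies every column separately; the
gradients act on rows, for which \<open>frob_inner_rows\<close> below is the suitable form.
\<close>

definition frob_inner :: "real mat \<Rightarrow> real mat \<Rightarrow> real" where
  "frob_inner A B = (\<Sum>j<dim_col A. col A j \<bullet> col B j)"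

lemma frob_inner_entries:
  assumes "A \<in> carrier_mat n p" "B \<in> carrier_mat n p"
  shows "frob_inner A B = (\<Sum>i<n. \<Sum>j<p. A $$ (i, j) * B $$ (i, j))"
  using assms by (subst sum.swap) (simp add: frob_inner_def scalar_prod_def atLeast0LessThan)

lemma frob_inner_rows:
  assumes "A \<in> carrier_mat n p" "B \<in> carrier_mat n p"
  shows "frob_inner A B = (\<Sum>i<n. row A i \<bullet> row B i)"
  using assms by (simp add: frob_inner_entries scalar_prod_def atLeast0LessThan)

lemma frobenius_norm_square:
  assumes "A \<in> carrier_mat n p"
  shows "(frobenius_norm A)\<^sup>2 = frob_inner A A"
proof -
  have "(frobenius_norm A)\<^sup>2 = (\<Sum>i<dim_row A. \<Sum>j<dim_col A. (A $$ (i, j))\<^sup>2)"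
    unfolding frobenius_norm_def by (intro real_sqrt_pow2 sum_nonneg) auto
  then show ?thesis
    using assms by (simp add: frob_inner_entries[OF assms assms] power2_eq_square)
qed

lemma frob_inner_self_nonneg: "frob_inner A A \<ge> 0"
  unfolding frob_inner_def by (intro sum_nonneg scalar_prod_self_nonneg)

lemma frob_inner_commute:
  assumes "A \<in> carrier_mat n p" "B \<in> carrier_mat n p"
  shows "frob_inner A B = frob_inner B A"
  using assms by (simp add: frob_inner_entries[of _ n p] mult.commute)

lemma frob_inner_add_left:
  assumes "A \<in> carrier_mat n p" "B \<in> carrier_mat n p" "C \<in> carrier_mat n p"
  shows "frob_inner (A + B) C = frob_inner A C + frob_inner B C"
  using assms by (simp add: frob_inner_entries[of _ n p] algebra_simps sum.distrib)

lemma frob_inner_smult_left: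
  assumes "A \<in> carrier_mat n p" "B \<in> carrier_mat n p"
  shows "frob_inner (a \<cdot>\<^sub>m A) B = a * frob_inner A B"
  using assms by (simp add: frob_inner_entries[of _ n p] sum_distrib_left mult.assoc)

lemma frob_inner_add_right:
  assumes "A \<in> carrier_mat n p" "B \<in> carrier_mat n p" "C \<in> carrier_mat n p"
  shows "frob_inner C (A + B) = frob_inner C A + frob_inner C B"
  using assms by (simp add: frob_inner_entries[of _ n p] algebra_simps sum.distrib)

lemma frob_inner_smult_right:
  assumes "A \<in> carrier_mat n p" "B \<in> carrier_mat n p"
  shows "frob_inner B (a \<cdot>\<^sub>m A) = a * frob_inner B A"
  using assms by (simp add: frob_inner_entries[of _ n p] sum_distrib_left mult.left_commute)

lemma frob_inner_adjoint:
  assumes U: "U \<in> carrier_mat N n" and A: "A \<in> carrier_mat N p" and B: "B \<in> carrier_mat n p"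
  shows "frob_inner (U\<^sup>T * A) B = frob_inner A (U * B)"
proof -
  have Ut: "U\<^sup>T \<in> carrier_mat n N" and dims: "dim_col (U\<^sup>T * A) = p" "dim_col A = p"
    using U A by auto
  have "frob_inner (U\<^sup>T * A) B = (\<Sum>j<p. (U\<^sup>T *\<^sub>v col A j) \<bullet> col B j)"
    unfolding frob_inner_def dims by (intro sum.cong refl) (simp only: lessThan_iff col_mult2[OF Ut A])
  also have "\<dots> = (\<Sum>j<p. col A j \<bullet> (U *\<^sub>v col B j))"
    using U A B by (intro sum.cong refl transpose_vec_mult_scalar) auto
  also have "\<dots> = frob_inner A (U * B)"
    unfolding frob_inner_def dims by (intro sum.cong refl) (simp only: lessThan_iff col_mult2[OF U B])
  finally show ?thesis .
qed

lemma frob_inner_mult_self: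
  assumes U: "U \<in> carrier_mat N n" and A: "A \<in> carrier_mat n p"
  shows "frob_inner (U * A) (U * A) = (\<Sum>j<p. (U *\<^sub>v col A j) \<bullet> (U *\<^sub>v col A j))"
proof -
  have "dim_col (U * A) = p"
    using A by simp
  then show ?thesis
    unfolding frob_inner_def by (intro sum.cong) (simp_all only: lessThan_iff col_mult2[OF U A])
qed

lemma frob_inner_mult_le:
  assumes U: "U \<in> carrier_mat N n" and A: "A \<in> carrier_mat n p"
    and le: "\<And>v. v \<in> carrier_vec n \<Longrightarrow> (U *\<^sub>v v) \<bullet> (U *\<^sub>v v) \<le> v \<bullet> v"
  shows "frob_inner (U * A) (U * A) \<le> frob_inner A A"
  unfolding frob_inner_mult_self[OF U A]
  unfolding frob_inner_def carrier_matD(2)[OF A]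
  using A by (intro sum_mono le col_carrier_vec) auto

lemma frob_inner_mult_ge:
  assumes U: "U \<in> carrier_mat N n" and A: "A \<in> carrier_mat n p"
    and le: "\<And>v. v \<in> carrier_vec n \<Longrightarrow> l * (v \<bullet> v) \<le> (U *\<^sub>v v) \<bullet> (U *\<^sub>v v)"
  shows "l * frob_inner A A \<le> frob_inner (U * A) (U * A)"
  unfolding frob_inner_mult_self[OF U A]
  unfolding frob_inner_def carrier_matD(2)[OF A] sum_distrib_left
  using A by (intro sum_mono le col_carrier_vec) auto

text \<open>
A contraction has a contractive adjoint; here this follows by expanding the square of
\<open>A - U U\<^sup>T A\<close>.
\<close>

lemma transpose_contraction:
  assumes U: "U \<in> carrier_mat N n" and A: "A \<in> carrier_mat N p"
    and le: "\<And>v. v \<in> carrier_vec n \<Longrightarrow> (U *\<^sub>v v) \<bullet> (U *\<^sub>v v) \<le> v \<bullet> v"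
  shows "frob_inner (U\<^sup>T * A) (U\<^sup>T * A) \<le> frob_inner A A"
proof -
  have UA: "U\<^sup>T * A \<in> carrier_mat n p" using U A by simp
  then have UUA: "U * (U\<^sup>T * A) \<in> carrier_mat N p" using U by simp
  have "0 \<le> frob_inner (A + (-1) \<cdot>\<^sub>m (U * (U\<^sup>T * A))) (A + (-1) \<cdot>\<^sub>m (U * (U\<^sup>T * A)))"
    by (rule frob_inner_self_nonneg)
  also have "\<dots> = frob_inner A A - 2 * frob_inner A (U * (U\<^sup>T * A))
      + frob_inner (U * (U\<^sup>T * A)) (U * (U\<^sup>T * A))"
    using A UUA frob_inner_commute[OF A UUA]
    by (simp add: frob_inner_add_left[of _ N p] frob_inner_add_right[of _ N p]
        frob_inner_smult_left[of _ N p] frob_inner_smult_right[of _ N p])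
  also have "frob_inner A (U * (U\<^sup>T * A)) = frob_inner (U\<^sup>T * A) (U\<^sup>T * A)"
    using frob_inner_adjoint[OF U A UA] by simp
  also have "frob_inner (U * (U\<^sup>T * A)) (U * (U\<^sup>T * A)) \<le> frob_inner (U\<^sup>T * A) (U\<^sup>T * A)"
    by (rule frob_inner_mult_le[OF U UA le])
  finally show ?thesis by simp
qed

section \<open>Optimality conditions\<close>

lemma feasible_point_iff:
  assumes r: "\<And>i. i < n \<Longrightarrow> r i \<in> carrier_vec p"
  shows "feasible_point n p r X \<longleftrightarrow> X \<in> carrier_mat n p \<and>
    (\<forall>l<p. (\<Sum>i<n. X $$ (i, l) - r i $ l) = 0)"
proof (cases "X \<in> carrier_mat n p")
  case True
  let ?d = "\<lambda>i. row X i - r i"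
  have d: "?d \<in> {..<n} \<rightarrow> carrier_vec p"
    using True r by auto
  let ?s = "finsum_vec TYPE(real) p ?d {..<n}"
  have "?s \<in> carrier_vec p"
    by (rule finsum_vec_closed[OF d])
  then have "?s = 0\<^sub>v p \<longleftrightarrow> (\<forall>l<p. ?s $ l = 0)"
    by (auto intro!: eq_vecI)
  moreover have "?s $ l = (\<Sum>i<n. X $$ (i, l) - r i $ l)"
    if l: "l < p" for l
  proof -
    have "(row X i - r i) $ l = X $$ (i, l) - r i $ l" if "i < n" for i
      using r[OF that] True l that by simp
    then show ?thesis
      using index_finsum_vec[OF _ l d] by simp
  qed
  ultimately show ?thesis
    using True by (simp add: feasible_point_def)
qed (simp add: feasible_point_def)

text \<open>
Moving \<open>s v\<close> from agent \<open>j\<close> to agent \<open>i\<close> keeps a point feasible, so the derivative of the objective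
along this motion vanishes at the optimum. With \<open>v\<close> the difference of the two gradients, that
derivative is \<open>v \<bullet> v\<close>.
\<close>

lemma optimal_solution_equal_gradients:
  assumes opt: "optimal_solution n p f r X"
    and diff: "\<And>i. i < n \<Longrightarrow> differentiable_fun p (f i)"
    and r: "\<And>i. i < n \<Longrightarrow> r i \<in> carrier_vec p"
    and i: "i < n" and j: "j < n"
  shows "gradient p (f i) (row X i) = gradient p (f j) (row X j)"
proof (cases "i = j")
  case False
  let ?g = "\<lambda>k. gradient p (f k) (row X k)"
  have X: "X \<in> carrier_mat n p" and feas: "\<And>l. l < p \<Longrightarrow> (\<Sum>k<n. X $$ (k, l) - r k $ l) = 0"
    using opt by (auto simp: optimal_solution_def feasible_point_iff[OF r])
  have row: "row X k \<in> carrier_vec p" for k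
    using X by (simp add: carrier_vecI)
  have g: "?g k \<in> carrier_vec p" if "k < n" for k
    using gradient_carrier[OF diff[OF that] row] .
  define v where "v = ?g i - ?g j"
  have v: "v \<in> carrier_vec p" using g i j by (simp add: v_def)
  define \<sigma> :: "nat \<Rightarrow> real" where "\<sigma> k = (if k = i then 1 else if k = j then - 1 else 0)" for k
  have \<sigma>: "(\<Sum>k<n. \<sigma> k) = 0"
  proof -
    have "(\<Sum>k<n. \<sigma> k) = (\<Sum>k<n. (if k = i then 1 else 0) - (if k = j then 1 else 0))"
      using False by (intro sum.cong) (auto simp: \<sigma>_def)
    then show ?thesis using i j by (simp add: sum_subtractf)
  qed
  define Z where "Z s = mat n p (\<lambda>(k, l). X $$ (k, l) + s * \<sigma> k * v $ l)" for s
  have rowZ: "row (Z s) k = row X k + (s * \<sigma> k) \<cdot>\<^sub>v v" if "k < n" for s k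
    using that X v by (intro eq_vecI) (auto simp: Z_def)
  have feasZ: "feasible_point n p r (Z s)" for s
    unfolding feasible_point_iff[of n r p, OF r, simplified]
  proof (intro conjI allI impI)
    show "Z s \<in> carrier_mat n p" by (simp add: Z_def)
    fix l assume l: "l < p"
    have "(\<Sum>k<n. Z s $$ (k, l) - r k $ l) = (\<Sum>k<n. (X $$ (k, l) - r k $ l) + s * v $ l * \<sigma> k)"
      using l by (intro sum.cong) (auto simp: Z_def)
    also have "\<dots> = 0"
      using feas[OF l] \<sigma> by (simp add: sum.distrib flip: sum_distrib_left)
    finally show "(\<Sum>k<n. Z s $$ (k, l) - r k $ l) = 0" .
  qed
  define \<phi> where "\<phi> s = (\<Sum>k<n. f k (row X k + s \<cdot>\<^sub>v (\<sigma> k \<cdot>\<^sub>v v)))" for s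
  have "\<phi> s = (\<Sum>k<n. f k (row (Z s) k))" for s
    unfolding \<phi>_def using v by (intro sum.cong) (auto simp: rowZ smult_smult_assoc)
  moreover have "Z 0 = X"
    using X by (intro eq_matI) (auto simp: Z_def)
  ultimately have "\<phi> 0 \<le> \<phi> s" for s
    using opt feasZ[of s] by (simp add: optimal_solution_def)
  moreover have "(\<phi> has_real_derivative (\<Sum>k<n. gradient p (f k) (row X k + 0 \<cdot>\<^sub>v (\<sigma> k \<cdot>\<^sub>v v)) \<bullet> (\<sigma> k \<cdot>\<^sub>v v))) (at 0)"
    unfolding \<phi>_def[abs_def] using v row diff by (intro DERIV_sum line_derivative) auto
  ultimately have "(\<Sum>k<n. gradient p (f k) (row X k + 0 \<cdot>\<^sub>v (\<sigma> k \<cdot>\<^sub>v v)) \<bullet> (\<sigma> k \<cdot>\<^sub>v v)) = 0"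
    by (intro DERIV_local_min[of \<phi> _ 0 1]) auto
  moreover have "row X k + 0 \<cdot>\<^sub>v (\<sigma> k \<cdot>\<^sub>v v) = row X k" for k
    using X v by (intro eq_vecI) auto
  ultimately have "0 = (\<Sum>k<n. ?g k \<bullet> (\<sigma> k \<cdot>\<^sub>v v))"
    by simp
  also have "\<dots> = (\<Sum>k<n. (if k = i then ?g i \<bullet> v else 0) - (if k = j then ?g j \<bullet> v else 0))"
    using g v False by (intro sum.cong) (auto simp: \<sigma>_def)
  also have "\<dots> = ?g i \<bullet> v - ?g j \<bullet> v"
    using i j by (simp add: sum_subtractf)
  also have "\<dots> = v \<bullet> v"
    using minus_scalar_prod_distrib[of "?g i" p "?g j" v] g i j v by (simp add: v_def)
  finally have "v = 0\<^sub>v p"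
    using scalar_prod_self_pos[OF v] by force
  show ?thesis
  proof (rule eq_vecI)
    fix l assume "l < dim_vec (?g j)"
    then show "?g i $ l = ?g j $ l"
      using \<open>v = 0\<^sub>v p\<close> g i j unfolding v_def
      by (metis carrier_vecD eq_iff_diff_eq_0 index_minus_vec(1) index_zero_vec(1))
  qed (use g i j in \<open>metis carrier_vecD\<close>)
qed simp

section \<open>Gradients of all agents and the matrix form of the algorithm\<close>

definition gradient_matrix :: "nat \<Rightarrow> nat \<Rightarrow> (nat \<Rightarrow> real vec \<Rightarrow> real) \<Rightarrow> real mat \<Rightarrow> real mat" where
  "gradient_matrix n p f X = mat n p (\<lambda>(i, l). gradient p (f i) (row X i) $ l)"

lemma gradient_matrix_carrier [simp]: "gradient_matrix n p f X \<in> carrier_mat n p"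
  by (simp add: gradient_matrix_def)

lemma row_gradient_matrix:
  assumes "differentiable_fun p (f i)" "X \<in> carrier_mat n p" "i < n"
  shows "row (gradient_matrix n p f X) i = gradient p (f i) (row X i)"
proof -
  have "row X i \<in> carrier_vec p"
    using assms(2) by (simp add: carrier_vecI)
  then have "dim_vec (gradient p (f i) (row X i)) = p"
    by (intro carrier_vecD gradient_carrier[OF assms(1)])
  then show ?thesis
    using assms(3) by (intro eq_vecI) (auto simp: gradient_matrix_def)
qed

text \<open>
Both inequalities hold agent by agent; replacing \<open>lip i\<close> by \<open>L\<close> is allowed because the inner product
of the \<open>i\<close>-th rows is nonnegative by monotonicity.
\<close>

lemma gradient_matrix_cocoercive_convex:
  fixes lip mu :: "nat \<Rightarrow> real"
  assumes p: "p > 0" and X: "X \<in> carrier_mat n p" and Z: "Z \<in> carrier_mat n p"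
    and diff: "\<And>i. i < n \<Longrightarrow> differentiable_fun p (f i)"
    and lip: "\<And>i. i < n \<Longrightarrow> lipschitz_gradient p (f i) (lip i)"
    and mu: "\<And>i. i < n \<Longrightarrow> 0 < mu i"
    and cvx: "\<And>i. i < n \<Longrightarrow> strongly_convex p (f i) (mu i)"
    and L: "\<And>i. i < n \<Longrightarrow> lip i \<le> L" and m: "\<And>i. i < n \<Longrightarrow> m \<le> mu i"
  defines "D \<equiv> gradient_matrix n p f X - gradient_matrix n p f Z"
  shows "frob_inner D D \<le> L * frob_inner (X - Z) D"
    and "m * frob_inner (X - Z) (X - Z) \<le> frob_inner (X - Z) D"
proof -
  have car: "D \<in> carrier_mat n p" "X - Z \<in> carrier_mat n p"
    unfolding D_def by (rule minus_carrier_mat, rule gradient_matrix_carrier)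
      (rule minus_carrier_mat[OF Z])
  have agent: "row D i \<bullet> row D i \<le> L * (row (X - Z) i \<bullet> row D i)"
    "m * (row (X - Z) i \<bullet> row (X - Z) i) \<le> row (X - Z) i \<bullet> row D i" if i: "i < n" for i
  proof -
    let ?x = "row X i" and ?z = "row Z i"
    define d where "d = gradient p (f i) ?x - gradient p (f i) ?z"
    have x: "?x \<in> carrier_vec p" and z: "?z \<in> carrier_vec p"
      using X Z by (auto simp: carrier_vecI)
    have d: "d \<in> carrier_vec p"
      using gradient_carrier[OF diff[OF i]] x z by (simp add: d_def)
    have rows: "row (X - Z) i = ?x - ?z" "row D i = d"
    proof -
      show "row (X - Z) i = ?x - ?z"
        using X Z i by (intro eq_vecI) auto
      have "row D i = row (gradient_matrix n p f X) i - row (gradient_matrix n p f Z) i"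
        using i by (intro eq_vecI) (auto simp: D_def gradient_matrix_def)
      then show "row D i = d"
        using row_gradient_matrix[of p f i X n] row_gradient_matrix[of p f i Z n] diff[OF i] i X Z by (simp add: d_def)
    qed
    have sw: "d \<bullet> (?x - ?z) = (?x - ?z) \<bullet> d"
      using d x z by (intro comm_scalar_prod[where n = p]) auto
    have mono: "mu i * ((?x - ?z) \<bullet> (?x - ?z)) \<le> (?x - ?z) \<bullet> d"
      using cvx[OF i] x z unfolding strongly_convex_def sw[symmetric] by (simp add: d_def enorm_square)
    have nn: "0 \<le> (?x - ?z) \<bullet> (?x - ?z)"
      by (rule scalar_prod_self_nonneg)
    then have "0 \<le> mu i * ((?x - ?z) \<bullet> (?x - ?z))"
      using mu[OF i] by simp
    then have pos: "0 \<le> (?x - ?z) \<bullet> d"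
      using mono by linarith
    have "lip i > 0"
      using lipschitz_constant_ge_convexity_modulus[OF p diff[OF i] lip[OF i] cvx[OF i]] mu[OF i] by simp
    then have "d \<bullet> d \<le> lip i * ((?x - ?z) \<bullet> d)"
      using gradient_cocoercive[OF diff[OF i] lip[OF i] _ _ cvx[OF i] x z] mu[OF i] sw
      by (simp add: d_def)
    also have "\<dots> \<le> L * ((?x - ?z) \<bullet> d)"
      using L[OF i] pos by (rule mult_right_mono)
    finally show "row D i \<bullet> row D i \<le> L * (row (X - Z) i \<bullet> row D i)"
      by (simp add: rows)
    have "m * ((?x - ?z) \<bullet> (?x - ?z)) \<le> mu i * ((?x - ?z) \<bullet> (?x - ?z))"
      using m[OF i] nn by (rule mult_right_mono)
    then show "m * (row (X - Z) i \<bullet> row (X - Z) i) \<le> row (X - Z) i \<bullet> row D i"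
      using mono by (simp add: rows)
  qed
  show "frob_inner D D \<le> L * frob_inner (X - Z) D"
    unfolding frob_inner_rows[OF car(1,1)] frob_inner_rows[OF car(2,1)] sum_distrib_left
    using agent(1) by (intro sum_mono) simp
  show "m * frob_inner (X - Z) (X - Z) \<le> frob_inner (X - Z) D"
    unfolding frob_inner_rows[OF car(2,2)] frob_inner_rows[OF car(2,1)] sum_distrib_left
    using agent(2) by (intro sum_mono) simp
qed

lemma mirror_extra_state_carrier:
  assumes "X0 \<in> carrier_mat n p"
  shows "fst (mirror_extra_state n p E A f r c X0 k) \<in> carrier_mat n p"
    and "snd (mirror_extra_state n p E A f r c X0 k) \<in> carrier_mat n p"
  using assms by (cases k; simp add: Let_def split: prod.splits)+

text \<open>
Compatibility with the graph lets the sum over a neighborhood run over all agents, so the mixing step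
is one matrix product.
\<close>

lemma mirror_extra_state_Suc:
  fixes X0 :: "real mat" and c :: real
  assumes E: "simple_graph n E" and A: "graph_compatible n E A"
    and diff: "\<And>i. i < n \<Longrightarrow> differentiable_fun p (f i)"
    and r: "\<And>i. i < n \<Longrightarrow> r i \<in> carrier_vec p"
    and X0: "X0 \<in> carrier_mat n p"
  defines "X k \<equiv> mirror_extra n p E A f r c X0 k"
    and "Y k \<equiv> snd (mirror_extra_state n p E A f r c X0 k)"
  shows "Y (Suc k) = Y k + A * gradient_matrix n p f (X k)"
    and "X (Suc k) = mat\<^sub>r n p r + (- 2 * c) \<cdot>\<^sub>m Y (Suc k) + c \<cdot>\<^sub>m Y k"
proof -
  note car = mirror_extra_state_carrier[OF X0, of E A f r c]
  have Xc: "X k \<in> carrier_mat n p" and Yc: "Y k \<in> carrier_mat n p" for k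
    using car by (simp_all add: X_def Y_def mirror_extra_def)
  have Ac: "A \<in> carrier_mat n n" using A by (simp add: graph_compatible_def)
  let ?G = "\<lambda>j. gradient p (f j) (row (X k) j)"
  define S where "S i = finsum_vec TYPE(real) p (\<lambda>j. A $$ (i, j) \<cdot>\<^sub>v ?G j) (neighbors E i \<union> {i})" for i
  have step: "Y (Suc k) = mat\<^sub>r n p (\<lambda>i. row (Y k) i + S i)"
    "X (Suc k) = mat\<^sub>r n p (\<lambda>i. r i - (2 * c) \<cdot>\<^sub>v row (Y (Suc k)) i + c \<cdot>\<^sub>v row (Y k) i)"
    by (simp_all add: X_def Y_def S_def mirror_extra_def Let_def split: prod.splits)
  have row: "row (X k) j \<in> carrier_vec p" for j
    using Xc[of k] by (simp add: carrier_vecI)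
  have S: "S i \<in> carrier_vec p" "l < p \<Longrightarrow> S i $ l = (\<Sum>j<n. A $$ (i, j) * ?G j $ l)"
    if i: "i < n" for i l
  proof -
    have nb: "neighbors E i \<union> {i} \<subseteq> {..<n}"
      using E i by (fastforce simp: neighbors_def simple_graph_def doubleton_eq_iff)
    have G: "(\<lambda>j. A $$ (i, j) \<cdot>\<^sub>v ?G j) \<in> neighbors E i \<union> {i} \<rightarrow> carrier_vec p"
      using nb gradient_carrier[OF diff row] by auto
    show "S i \<in> carrier_vec p"
      unfolding S_def by (rule finsum_vec_closed[OF G])
    assume l: "l < p"
    have "S i $ l = (\<Sum>j\<in>neighbors E i \<union> {i}. (A $$ (i, j) \<cdot>\<^sub>v ?G j) $ l)"
      unfolding S_def using finite_subset[OF nb] by (intro index_finsum_vec l G) auto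
    also have "\<dots> = (\<Sum>j\<in>neighbors E i \<union> {i}. A $$ (i, j) * ?G j $ l)"
    proof (intro sum.cong refl)
      fix j assume "j \<in> neighbors E i \<union> {i}"
      then have "dim_vec (?G j) = p"
        using nb by (intro carrier_vecD gradient_carrier[OF diff row]) auto
      then show "(A $$ (i, j) \<cdot>\<^sub>v ?G j) $ l = A $$ (i, j) * ?G j $ l"
        using l by simp
    qed
    also have "\<dots> = (\<Sum>j<n. A $$ (i, j) * ?G j $ l)"
      using nb A i by (intro sum.mono_neutral_left) (auto simp: graph_compatible_def neighbors_def)
    finally show "S i $ l = (\<Sum>j<n. A $$ (i, j) * ?G j $ l)" .
  qed
  show "Y (Suc k) = Y k + A * gradient_matrix n p f (X k)"
  proof (rule eq_matI)
    fix i l assume "i < dim_row (Y k + A * gradient_matrix n p f (X k))"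
      "l < dim_col (Y k + A * gradient_matrix n p f (X k))"
    then have il: "i < n" "l < p"
      using Ac by (auto simp: gradient_matrix_def)
    then show "Y (Suc k) $$ (i, l) = (Y k + A * gradient_matrix n p f (X k)) $$ (i, l)"
      using Ac Yc[of k] S[OF il(1)]
      by (simp add: step(1) gradient_matrix_def scalar_prod_def atLeast0LessThan)
  qed (use Ac step in \<open>auto simp: gradient_matrix_def\<close>)
  show "X (Suc k) = mat\<^sub>r n p r + (- 2 * c) \<cdot>\<^sub>m Y (Suc k) + c \<cdot>\<^sub>m Y k"
  proof (rule eq_matI)
    fix i l assume "i < dim_row (mat\<^sub>r n p r + (- 2 * c) \<cdot>\<^sub>m Y (Suc k) + c \<cdot>\<^sub>m Y k)"
      "l < dim_col (mat\<^sub>r n p r + (- 2 * c) \<cdot>\<^sub>m Y (Suc k) + c \<cdot>\<^sub>m Y k)"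
    then have il: "i < n" "l < p"
      using Yc[of k] by auto
    then show "X (Suc k) $$ (i, l) = (mat\<^sub>r n p r + (- 2 * c) \<cdot>\<^sub>m Y (Suc k) + c \<cdot>\<^sub>m Y k) $$ (i, l)"
      using Yc[of k] Yc[of "Suc k"] r[OF il(1)] by (simp add: step(2))
  qed (use Yc[of k] step in auto)
qed

section \<open>Contraction of the Lyapunov function\<close>

text \<open>
One step of the iteration in abstract form: \<open>w\<close> stands for the dual error, in coordinates in which the
error of \<open>y\<close> is \<open>U\<^sup>T w\<close>, while \<open>d\<close> and \<open>d'\<close> are two successive gradient differences and \<open>e'\<close> is
the next primal error. Expanding \<open>|w + U d'|\<^sup>2\<close> produces the term \<open>- (2 / c) (e' \<bullet> d')\<close>, which is
large by cocoercivity because \<open>2 c L < 1\<close>, and the cross term \<open>- 2 (U d \<bullet> U d')\<close> caused by the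
extrapolation; the extra summand with \<open>U d\<close> in the Lyapunov function absorbs that cross term. Its
weight must exceed \<open>1\<close> for some multiple of \<open>|U d|\<^sup>2\<close> to be left over, and \<open>3 / 2\<close> leaves
\<open>|U d|\<^sup>2 / 2\<close> together with \<open>(e' \<bullet> d') / (4 c)\<close>. These two terms dominate the Lyapunov
function itself: \<open>U\<^sup>T w\<close> is a combination of \<open>e'\<close> and \<open>U\<^sup>T U d\<close>, and the expansion bound
recovers \<open>|w|\<close> from \<open>|U\<^sup>T w|\<close>.
\<close>

lemma lyapunov_step:
  assumes U: "U \<in> carrier_mat N n" and w: "w \<in> carrier_mat N p"
    and d: "d \<in> carrier_mat n p" and d': "d' \<in> carrier_mat n p" and e': "e' \<in> carrier_mat n p"
    and contraction: "\<And>v. v \<in> carrier_vec n \<Longrightarrow> (U *\<^sub>v v) \<bullet> (U *\<^sub>v v) \<le> v \<bullet> v"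
    and expansion: "\<And>v. v \<in> carrier_vec N \<Longrightarrow> l * (v \<bullet> v) \<le> (U\<^sup>T *\<^sub>v v) \<bullet> (U\<^sup>T *\<^sub>v v)"
    and l: "0 < l" "l \<le> 1" and c: "0 < c" "2 * c * L < 1" and m: "0 < m" "m \<le> L"
    and coco: "frob_inner d' d' \<le> L * frob_inner e' d'"
    and cvx: "m * frob_inner e' e' \<le> frob_inner e' d'"
    and e'_def: "e' = (- c) \<cdot>\<^sub>m (U\<^sup>T * (w + U * d))"
  defines "w' \<equiv> w + U * d'"
  shows "frob_inner w' w' + 3 / 2 * frob_inner (U * d') (U * d')
      \<le> (1 - c * m * l / 8) * (frob_inner w w + 3 / 2 * frob_inner (U * d) (U * d))" (is ?contract)
    and "frob_inner e' e' \<le> 4 * c / m * (frob_inner w w + 3 / 2 * frob_inner (U * d) (U * d))"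
      (is ?error)
proof -
  let ?h = "U * d" and ?h' = "U * d'"
  let ?T = "U\<^sup>T * w" and ?T' = "U\<^sup>T * ?h"
  have h: "?h \<in> carrier_mat N p" "?h' \<in> carrier_mat N p"
    using U d d' by auto
  have T: "?T \<in> carrier_mat n p" "?T' \<in> carrier_mat n p"
    using U w h by auto
  have e: "e' = (- c) \<cdot>\<^sub>m (?T + ?T')"
    unfolding e'_def using mult_add_distrib_mat[of "U\<^sup>T" n N w p ?h] U w h by simp
  define a b b' s q q' where "a = frob_inner w w" and "b = frob_inner ?h ?h"
    and "b' = frob_inner ?h' ?h'" and "s = frob_inner e' d'"
    and "q = frob_inner w ?h'" and "q' = frob_inner ?h ?h'"
  note defs = a_def b_def b'_def s_def q_def q'_def
  note expand = frob_inner_add_left frob_inner_add_right frob_inner_smult_left frob_inner_smult_right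
  have w'sq: "frob_inner w' w' = a + 2 * q + b'"
    using w h frob_inner_commute[OF w h(2)]
    by (simp add: w'_def defs expand[of _ N p])
  have s: "s = - c * q - c * q'"
    using T d' frob_inner_adjoint[OF U w d'] frob_inner_adjoint[OF U h(1) d']
    by (simp add: defs e expand[of _ n p] algebra_simps)
  have q': "- 2 * q' \<le> b + b'"
  proof -
    have "0 \<le> frob_inner (?h + ?h') (?h + ?h')" by (rule frob_inner_self_nonneg)
    also have "\<dots> = b + 2 * q' + b'"
      using h frob_inner_commute[OF h] by (simp add: defs expand[of _ N p])
    finally show ?thesis by simp
  qed
  have b': "b' \<le> L * s"
    using frob_inner_mult_le[OF U d' contraction] coco by (simp add: defs)
  have "0 \<le> m * frob_inner e' e'"
    using m frob_inner_self_nonneg[of e'] by simp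
  then have s0: "s \<ge> 0"
    using cvx by (simp add: s_def)
  have b0: "b \<ge> 0"
    by (simp add: b_def frob_inner_self_nonneg)
  have ee: "frob_inner e' e' \<le> s / m"
    using cvx m by (simp add: defs field_simps)
  \<comment> \<open>Solving \<open>e' = - c (T + T')\<close> for \<open>T\<close> costs a factor 2 by convexity of the square.\<close>
  have a: "l * a \<le> 2 * s / (c\<^sup>2 * m) + 2 * b"
  proof -
    have "l * a \<le> frob_inner ?T ?T"
      unfolding a_def using U by (intro frob_inner_mult_ge[of _ n N _ p] w expansion) auto
    also have "frob_inner ?T ?T \<le> 2 / c\<^sup>2 * frob_inner e' e' + 2 * frob_inner ?T' ?T'"
    proof -
      have TT: "frob_inner ?T' ?T = frob_inner ?T ?T'"
        by (rule frob_inner_commute[OF T(2,1)])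
      have "0 \<le> frob_inner (?T + 2 \<cdot>\<^sub>m ?T') (?T + 2 \<cdot>\<^sub>m ?T')" by (rule frob_inner_self_nonneg)
      also have "\<dots> = frob_inner ?T ?T + 4 * frob_inner ?T ?T' + 4 * frob_inner ?T' ?T'"
        using T by (simp add: expand[of _ n p] TT)
      finally have "frob_inner ?T ?T \<le>
          2 * (frob_inner ?T ?T + 2 * frob_inner ?T ?T' + frob_inner ?T' ?T') + 2 * frob_inner ?T' ?T'"
        by simp
      moreover have "frob_inner e' e' =
          c\<^sup>2 * (frob_inner ?T ?T + 2 * frob_inner ?T ?T' + frob_inner ?T' ?T')"
        using T by (simp add: e expand[of _ n p] TT power2_eq_square algebra_simps)
      ultimately show ?thesis using c by simp
    qed
    also have "\<dots> \<le> 2 / c\<^sup>2 * (s / m) + 2 * b"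
      unfolding b_def using ee transpose_contraction[OF U h(1) contraction]
      by (intro add_mono mult_left_mono) auto
    finally show ?thesis by simp
  qed
  have cm: "c * m < 1 / 2"
    using mult_left_mono[OF m(2) less_imp_le[OF c(1)]] c(2) by (simp add: mult.assoc)
  define D where "D = b / 2 + s / (4 * c)"
  define V where "V = a + 3 / 2 * b"
  \<comment> \<open>The coefficient of \<open>s\<close> is \<open>2 / c - 7 L / 2 \<ge> 1 / (4 c)\<close>.\<close>
  have decrease: "frob_inner w' w' + 3 / 2 * b' \<le> V - D"
  proof -
    have "s / c = - q - q'"
      using c(1) unfolding s by (simp add: field_simps)
    then have "2 * q = - 2 * s / c - 2 * q'"
      by simp
    then have "frob_inner w' w' + 3 / 2 * b' \<le> a - 2 * (s / c) + b + 7 / 2 * b'"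
      using w'sq q' by simp
    moreover have "2 * (L * s) \<le> s / c"
    proof -
      have "(2 * c * L) * s \<le> 1 * s"
        using c(2) s0 by (intro mult_right_mono) auto
      then show ?thesis
        using c(1) by (simp add: pos_le_divide_eq mult_ac)
    qed
    moreover have "D = b / 2 + 1 / 4 * (s / c)"
      by (simp add: D_def)
    ultimately show ?thesis
      using b' by (simp add: V_def)
  qed
  \<comment> \<open>The factor 8 equates the coefficients of \<open>s\<close>; those of \<open>b\<close> then have room, as \<open>c m < 1 / 2\<close>.\<close>
  have domination: "c * m * l / 8 * V \<le> D"
  proof -
    have "c * m / 8 * (l * a) \<le> c * m / 8 * (2 * s / (c\<^sup>2 * m) + 2 * b)"
      using a c m by (intro mult_left_mono) auto
    also have "\<dots> = s / (4 * c) + (c * m) * b / 4"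
      using c(1) m(1) by (simp add: field_simps power2_eq_square)
    finally have "c * m / 8 * (l * a) \<le> s / (4 * c) + b / 8"
      using mult_right_mono[OF less_imp_le[OF cm] b0] by (simp add: mult_ac)
    moreover have "c * m * l / 8 * (3 / 2 * b) \<le> b / 8"
    proof -
      have "c * m * l \<le> 1 / 2 * 1"
        using cm c m l by (intro mult_mono) auto
      then have "c * m * l * b \<le> 1 / 2 * b"
        using b0 by (intro mult_right_mono) auto
      then show ?thesis using b0 by (simp add: mult_ac)
    qed
    ultimately show ?thesis using b0 by (simp add: V_def D_def algebra_simps)
  qed
  have "(1 - c * m * l / 8) * V = V - c * m * l / 8 * V"
    by (simp add: algebra_simps)
  then have "frob_inner w' w' + 3 / 2 * b' \<le> (1 - c * m * l / 8) * V"
    using decrease domination by linarith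
  then show ?contract
    by (simp only: V_def a_def b_def b'_def)
  have "0 \<le> frob_inner w' w' + 3 / 2 * b'"
    using frob_inner_self_nonneg[of w'] frob_inner_self_nonneg[of ?h'] by (simp add: b'_def)
  then have "s / (4 * c) \<le> V"
    using decrease b0 by (simp add: D_def)
  then have "s / m \<le> 4 * c / m * V"
    using c m by (simp add: field_simps)
  then show ?error
    using ee by (simp add: V_def defs)
qed

text \<open>
The optimal point satisfies \<open>r - x\<^sup>* = c y\<^sup>*\<close> for some \<open>y\<^sup>* = U\<^sup>T w\<^sup>*\<close>, because its residual has
zero column sums, and \<open>U\<close> annihilates the gradients at the optimum, because they agree. Hence the
errors obey the recursion of \<open>lyapunov_step\<close>. The initial point is arbitrary and need not
have the form \<open>r - 2 c y + c y'\<close>, so the estimate starts with the first iterate.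
\<close>

lemma mirror_extra_linear_convergence:
  fixes lip mu :: "nat \<Rightarrow> real" and c L m :: real and X0 Xopt :: "real mat"
  assumes n: "2 \<le> n" and p: "0 < p" and E: "simple_graph n E"
    and U: "laplacian_factor n U" and A: "graph_compatible n E (U\<^sup>T * U)"
    and top: "lambda_max (U\<^sup>T * U) \<le> 1"
    and r: "\<And>i. i < n \<Longrightarrow> r i \<in> carrier_vec p"
    and diff: "\<And>i. i < n \<Longrightarrow> differentiable_fun p (f i)"
    and lip: "\<And>i. i < n \<Longrightarrow> lipschitz_gradient p (f i) (lip i)"
    and mu: "\<And>i. i < n \<Longrightarrow> 0 < mu i"
    and cvx: "\<And>i. i < n \<Longrightarrow> strongly_convex p (f i) (mu i)"
    and L: "\<And>i. i < n \<Longrightarrow> lip i \<le> L" and m: "\<And>i. i < n \<Longrightarrow> m \<le> mu i" "0 < m" "m \<le> L"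
    and c: "0 < c" "2 * c * L < 1"
    and X0: "X0 \<in> carrier_mat n p" and opt: "optimal_solution n p f r Xopt"
  obtains K where "K \<ge> 0" "\<And>k. (frobenius_norm (mirror_extra n p E (U\<^sup>T * U) f r c X0 (Suc k) - Xopt))\<^sup>2
    \<le> K * (1 - c * m * lambda_min_nonzero (U\<^sup>T * U) / 8) ^ k"
proof -
  define N where "N = n - 1"
  let ?l = "lambda_min_nonzero (U\<^sup>T * U)"
  have Uc: "U \<in> carrier_mat N n" and Ut: "U\<^sup>T \<in> carrier_mat n N"
    using U by (auto simp: laplacian_factor_def N_def)
  define X where "X = mirror_extra n p E (U\<^sup>T * U) f r c X0"
  define Y where "Y k = snd (mirror_extra_state n p E (U\<^sup>T * U) f r c X0 k)" for k
  define G where "G = gradient_matrix n p f"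
  define D where "D k = G (X k) - G Xopt" for k
  have Xc: "X k \<in> carrier_mat n p" and Yc: "Y k \<in> carrier_mat n p" for k
    using mirror_extra_state_carrier[OF X0] by (auto simp: X_def Y_def mirror_extra_def)
  have step: "Y (Suc k) = Y k + (U\<^sup>T * U) * G (X k)"
    "X (Suc k) = mat\<^sub>r n p r + (- 2 * c) \<cdot>\<^sub>m Y (Suc k) + c \<cdot>\<^sub>m Y k" for k
    unfolding X_def Y_def G_def by (rule mirror_extra_state_Suc[OF E A _ _ X0]; fact diff r)+
  have feas: "Xopt \<in> carrier_mat n p" "\<And>l. l < p \<Longrightarrow> (\<Sum>i<n. Xopt $$ (i, l) - r i $ l) = 0"
    using opt feasible_point_iff[of n r p, OF r] by (auto simp: optimal_solution_def)
  have Gc: "G Z \<in> carrier_mat n p" for Z by (simp add: G_def)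
  have Dc: "D k \<in> carrier_mat n p" for k
    unfolding D_def by (rule minus_carrier_mat[OF Gc])
  have UG: "U * G Xopt = 0\<^sub>m N p"
    unfolding N_def
  proof (rule laplacian_factor_constant_columns[OF U Gc])
    fix i j l assume "i < n" "j < n" "l < p"
    then show "G Xopt $$ (i, l) = G Xopt $$ (j, l)"
      using optimal_solution_equal_gradients[OF opt, of i j] diff r by (simp add: G_def gradient_matrix_def)
  qed
  have UD: "U * D k = U * G (X k)" for k
  proof -
    have "U * D k = U * G (X k) - U * G Xopt"
      unfolding D_def using Uc Gc by (intro mult_minus_distrib_mat[of _ N n _ p]) auto
    also have "\<dots> = U * G (X k)"
      unfolding UG using Uc Gc[of "X k"] by (intro eq_matI) auto
    finally show ?thesis .
  qed
  have UDc: "U * D k \<in> carrier_mat N p" for k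
    using Uc Dc by auto
  obtain Ws where Ws: "Ws \<in> carrier_mat N p" "U\<^sup>T * Ws = (1 / c) \<cdot>\<^sub>m (mat\<^sub>r n p r - Xopt)"
  proof (rule laplacian_factor_transpose_range_mat[OF _ U])
    show "0 < n" using n by simp
    show "(1 / c) \<cdot>\<^sub>m (mat\<^sub>r n p r - Xopt) \<in> carrier_mat n p"
      by (intro smult_carrier_mat minus_carrier_mat feas)
    fix l assume l: "l < p"
    have "(\<Sum>i<n. ((1 / c) \<cdot>\<^sub>m (mat\<^sub>r n p r - Xopt)) $$ (i, l)) = (\<Sum>i<n. (- 1 / c) * (Xopt $$ (i, l) - r i $ l))"
      using l feas(1) r by (intro sum.cong) (auto simp: diff_divide_distrib)
    also have "\<dots> = 0"
      unfolding sum_distrib_left[symmetric] feas(2)[OF l] by simp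
    finally show "(\<Sum>i<n. ((1 / c) \<cdot>\<^sub>m (mat\<^sub>r n p r - Xopt)) $$ (i, l)) = 0" .
  qed (use that N_def in blast)
  define Ys where "Ys = U\<^sup>T * Ws"
  have Ysc: "Ys \<in> carrier_mat n p" unfolding Ys_def by (rule mult_carrier_mat[OF Ut Ws(1)])
  have Ys: "r i $ l - Xopt $$ (i, l) = c * Ys $$ (i, l)" if "i < n" "l < p" for i l
    using that feas(1) r[OF that(1)] c unfolding Ys_def Ws(2) by simp
  \<comment> \<open>The dual error relative to \<open>y\<^sup>*\<close>, pulled back along \<open>U\<^sup>T\<close>; it starts at \<open>- w\<^sup>*\<close> since \<open>y\<close> starts at 0.\<close>
  define W where "W = rec_nat ((-1) \<cdot>\<^sub>m Ws) (\<lambda>k w. w + U * D k)"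
  have W: "W 0 = (-1) \<cdot>\<^sub>m Ws" "W (Suc k) = W k + U * D k" for k
    by (simp_all add: W_def)
  have Wc: "W k \<in> carrier_mat N p" for k
    by (induction k) (use Ws UDc in \<open>auto simp: W\<close>)
  have UWc: "U\<^sup>T * W k \<in> carrier_mat n p" for k using Ut Wc by auto
  have UUDc: "U\<^sup>T * (U * D k) \<in> carrier_mat n p" for k using Ut UDc by auto
  have UWSuc: "U\<^sup>T * W (Suc k) = U\<^sup>T * W k + U\<^sup>T * (U * D k)" for k
    unfolding W by (rule mult_add_distrib_mat[OF Ut Wc UDc])
  have Y: "Y k = Ys + U\<^sup>T * W k" for k
  proof (induction k)
    case 0
    have "U\<^sup>T * W 0 = (-1) \<cdot>\<^sub>m Ys"
      unfolding W Ys_def by (rule mult_smult_distrib[OF Ut Ws(1)])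
    moreover have "Y 0 = 0\<^sub>m n p" by (simp add: Y_def)
    ultimately show ?case using Ysc by (intro eq_matI) auto
  next
    case (Suc k)
    have "(U\<^sup>T * U) * G (X k) = U\<^sup>T * (U * D k)"
      unfolding UD by (rule assoc_mult_mat[OF Ut Uc Gc])
    then show ?case
      unfolding step(1) Suc UWSuc using assoc_add_mat[OF Ysc UWc UUDc] by simp
  qed
  have Ec: "X k - Xopt \<in> carrier_mat n p" for k
    by (rule minus_carrier_mat[OF feas(1)])
  have error: "X (Suc k) - Xopt = (- c) \<cdot>\<^sub>m (U\<^sup>T * (W (Suc k) + U * D k))" for k
  proof (rule eq_matI)
    fix i l assume "i < dim_row ((- c) \<cdot>\<^sub>m (U\<^sup>T * (W (Suc k) + U * D k)))"
      "l < dim_col ((- c) \<cdot>\<^sub>m (U\<^sup>T * (W (Suc k) + U * D k)))"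
    then have il: "i < n" "l < p" using Ut Uc Dc[of k] by auto
    let ?T = "(U\<^sup>T * W k) $$ (i, l)" and ?S = "(U\<^sup>T * (U * D k)) $$ (i, l)"
    have Yk: "Y k $$ (i, l) = Ys $$ (i, l) + ?T"
      unfolding Y using il UWc[of k] by (subst index_add_mat) auto
    have YSk: "Y (Suc k) $$ (i, l) = Ys $$ (i, l) + (?T + ?S)"
      unfolding Y UWSuc using il Ysc UWc[of k] UUDc[of k]
      by (simp del: index_mult_mat)
    have "(X (Suc k) - Xopt) $$ (i, l) = r i $ l + (- 2 * c) * Y (Suc k) $$ (i, l) + c * Y k $$ (i, l) - Xopt $$ (i, l)"
      unfolding step(2) using il Yc[of k] Yc[of "Suc k"] feas(1) r[OF il(1)] by simp
    also have "\<dots> = - c * (?T + ?S + ?S)"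
      unfolding Yk YSk using Ys[OF il] by (simp add: algebra_simps)
    also have "\<dots> = ((- c) \<cdot>\<^sub>m (U\<^sup>T * W (Suc k) + U\<^sup>T * (U * D k))) $$ (i, l)"
      unfolding UWSuc using il UWc[of k] UUDc[of k] by (simp del: index_mult_mat)
    also have "U\<^sup>T * W (Suc k) + U\<^sup>T * (U * D k) = U\<^sup>T * (W (Suc k) + U * D k)"
      by (rule mult_add_distrib_mat[OF Ut Wc UDc, symmetric])
    finally show "(X (Suc k) - Xopt) $$ (i, l) = ((- c) \<cdot>\<^sub>m (U\<^sup>T * (W (Suc k) + U * D k))) $$ (i, l)" .
  qed (use Ut Uc Dc[of k] feas(1) in auto)
  have l: "0 < ?l" "?l \<le> 1"
    using lambda_min_nonzero_pos[OF n U top] lambda_min_nonzero_le_1[OF n U top] by auto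
  define V where "V k = frob_inner (W (Suc k)) (W (Suc k)) + 3 / 2 * frob_inner (U * D k) (U * D k)" for k
  define \<rho> where "\<rho> = 1 - c * m * ?l / 8"
  have bounds: "frob_inner (D k) (D k) \<le> L * frob_inner (X k - Xopt) (D k)"
    "m * frob_inner (X k - Xopt) (X k - Xopt) \<le> frob_inner (X k - Xopt) (D k)" for k
    unfolding D_def G_def
    by (rule gradient_matrix_cocoercive_convex[OF p Xc feas(1)]; fact diff lip mu cvx L m(1))+
  have contract: "V (Suc k) \<le> \<rho> * V k"
    and err: "frob_inner (X (Suc k) - Xopt) (X (Suc k) - Xopt) \<le> 4 * c / m * V k" for k
  proof -
    have contr: "\<And>v. v \<in> carrier_vec n \<Longrightarrow> (U *\<^sub>v v) \<bullet> (U *\<^sub>v v) \<le> v \<bullet> v"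
      by (rule laplacian_factor_contraction[OF n U top])
    have expan: "\<And>v. v \<in> carrier_vec N \<Longrightarrow> ?l * (v \<bullet> v) \<le> (U\<^sup>T *\<^sub>v v) \<bullet> (U\<^sup>T *\<^sub>v v)"
      unfolding N_def by (rule transpose_laplacian_factor_expansion[OF n U top])
    note ly = lyapunov_step[OF Uc Wc[of "Suc k"] Dc[of k] Dc[of "Suc k"] Ec[of "Suc k"] contr expan l c m(2,3)
        bounds(1) bounds(2) error]
    show "V (Suc k) \<le> \<rho> * V k"
      using ly(1) by (simp add: V_def \<rho>_def W(2)[of "Suc k"])
    show "frob_inner (X (Suc k) - Xopt) (X (Suc k) - Xopt) \<le> 4 * c / m * V k"
      using ly(2) by (simp add: V_def)
  qed
  have \<rho>0: "\<rho> \<ge> 0"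
  proof -
    have "c * m \<le> 1 / 2"
      using mult_left_mono[OF m(3) less_imp_le[OF c(1)]] c(2) by (simp add: mult.assoc)
    then have "c * m * ?l \<le> 1 / 2 * 1"
      using l c m by (intro mult_mono) auto
    then show ?thesis by (simp add: \<rho>_def)
  qed
  have decay: "V k \<le> \<rho> ^ k * V 0" for k
  proof (induction k)
    case (Suc k)
    have "V (Suc k) \<le> \<rho> * (\<rho> ^ k * V 0)"
      using contract[of k] mult_left_mono[OF Suc \<rho>0] by linarith
    then show ?case by (simp add: mult.assoc)
  qed simp
  show ?thesis
  proof (rule that)
    show "0 \<le> 4 * c / m * V 0"
      using c m by (simp add: V_def frob_inner_self_nonneg)
    fix k
    have "(frobenius_norm (X (Suc k) - Xopt))\<^sup>2 \<le> 4 * c / m * V k"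
      using err[of k] frobenius_norm_square[OF Ec] by simp
    also have "\<dots> \<le> 4 * c / m * (\<rho> ^ k * V 0)"
      using decay[of k] c m by (intro mult_left_mono) auto
    finally show "(frobenius_norm (mirror_extra n p E (U\<^sup>T * U) f r c X0 (Suc k) - Xopt))\<^sup>2
        \<le> 4 * c / m * V 0 * (1 - c * m * ?l / 8) ^ k"
      by (simp add: X_def \<rho>_def mult_ac)
  qed
qed

section \<open>Iteration complexity\<close>

text \<open>
The iteration number is positive since \<open>\<epsilon> < 1\<close>. The error after \<open>Suc j\<close> iterations carries only the
power \<open>j\<close> of the contraction factor; the missing factor is at least \<open>1 / 2\<close>.
\<close>

lemma geometric_decay_complexity:
  fixes \<delta> \<epsilon> :: real
  assumes \<delta>: "0 < \<delta>" "\<delta> \<le> 1 / 2" and \<epsilon>: "0 < \<epsilon>" "\<epsilon> < 1" and k: "real k \<ge> 1 / \<delta> * ln (1 / \<epsilon>)"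
  obtains j where "k = Suc j" "(1 - \<delta>) ^ j \<le> 2 * \<epsilon>"
proof -
  have "1 / \<delta> * ln (1 / \<epsilon>) > 0"
    using \<delta> \<epsilon> by simp
  with k obtain j where j: "k = Suc j"
    by (cases k) auto
  have "(1 - \<delta>) ^ k \<le> exp (- \<delta>) ^ k"
    using exp_ge_add_one_self[of "- \<delta>"] \<delta> by (intro power_mono) auto
  also have "\<dots> = exp (real k * - \<delta>)"
    by (rule exp_of_nat_mult[symmetric])
  also have "\<dots> \<le> exp (- ln (1 / \<epsilon>))"
  proof -
    have "ln (1 / \<epsilon>) \<le> real k * \<delta>"
      using k \<delta>(1) by (simp add: pos_divide_le_eq)
    then show ?thesis by simp
  qed
  also have "\<dots> = \<epsilon>"
    using \<epsilon> by (simp add: exp_minus)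
  finally have "(1 - \<delta>) * (1 - \<delta>) ^ j \<le> \<epsilon>"
    by (simp add: j)
  moreover have "1 / 2 * (1 - \<delta>) ^ j \<le> (1 - \<delta>) * (1 - \<delta>) ^ j"
    using \<delta> by (intro mult_right_mono) auto
  ultimately have "(1 - \<delta>) ^ j \<le> 2 * \<epsilon>"
    by linarith
  with j show ?thesis by (rule that)
qed

theorem corollary3:
  shows "\<exists>C :: real \<Rightarrow> real. (\<forall>t. 0 < t \<and> t < 1/2 \<longrightarrow> 0 < C t) \<and>
    (\<forall>(n :: nat) (p :: nat) (E :: nat set set) (U :: real Matrix.mat) (Lap :: real Matrix.mat)
      (f :: nat \<Rightarrow> real Matrix.vec \<Rightarrow> real) (r :: nat \<Rightarrow> real Matrix.vec)
      (lip :: nat \<Rightarrow> real) (mu :: nat \<Rightarrow> real) (c :: real)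
      (X0 :: real Matrix.mat) (Xopt :: real Matrix.mat)
      (L :: real) (m :: real) (kappa_f :: real) (kappa_L :: real).
        2 \<le> n \<and> 0 < p \<and>
        simple_graph n E \<and> connected_graph n E \<and>
        laplacian_factor n U \<and> Lap = transpose_mat U * U \<and>
        graph_compatible n E Lap \<and> lambda_max Lap \<le> 1 \<and>
        (\<forall>i<n. r i \<in> carrier_vec p) \<and>
        (\<forall>i<n. differentiable_fun p (f i) \<and> lipschitz_gradient p (f i) (lip i) \<and>
               0 < mu i \<and> strongly_convex p (f i) (mu i)) \<and>
        m = Min (mu ` {..<n}) \<and> L = Max (lip ` {..<n}) \<and>
        kappa_f = L / m \<and> kappa_L = 1 / lambda_min_nonzero Lap \<and>
        0 < c \<and> c < 1 / (2 * L) \<and>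
        X0 \<in> carrier_mat n p \<and>
        optimal_solution n p f r Xopt
      \<longrightarrow>
        (\<exists>M>0. \<forall>(\<epsilon> :: real) (k :: nat).
            0 < \<epsilon> \<and> \<epsilon> < 1 \<and> real k \<ge> C (c * L) * kappa_L * kappa_f * ln (1 / \<epsilon>) \<longrightarrow>
            (frobenius_norm (mirror_extra n p E Lap f r c X0 k - Xopt))\<^sup>2 \<le> M * \<epsilon>))"
\<comment> \<open>The contraction factor is \<open>1 - \<delta>\<close> with \<open>\<delta> = c m \<lambda> / 8 = c L / (8 \<kappa>\<^sub>L \<kappa>\<^sub>f)\<close>, where \<open>\<lambda>\<close> is
  the smallest nonzero eigenvalue, so \<open>C t = 8 / t\<close> gives exactly \<open>1 / \<delta>\<close>.\<close>
proof (intro exI[of _ "\<lambda>t. 8 / t"] conjI allI impI; (elim conjE)?)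
  fix t :: real assume "0 < t" then show "0 < 8 / t" by simp
next
  fix n p :: nat and E :: "nat set set" and U Lap :: "real mat" and f :: "nat \<Rightarrow> real vec \<Rightarrow> real"
    and r :: "nat \<Rightarrow> real vec" and lip mu :: "nat \<Rightarrow> real" and c :: real and X0 Xopt :: "real mat"
    and L m kappa_f kappa_L :: real
  assume n: "2 \<le> n" and p: "0 < p" and E: "simple_graph n E" and U: "laplacian_factor n U"
    and Lap: "Lap = U\<^sup>T * U" and A: "graph_compatible n E Lap" and top: "lambda_max Lap \<le> 1"
    and r: "\<forall>i<n. r i \<in> carrier_vec p"
    and f: "\<forall>i<n. differentiable_fun p (f i) \<and> lipschitz_gradient p (f i) (lip i) \<and>
               0 < mu i \<and> strongly_convex p (f i) (mu i)"
    and m: "m = Min (mu ` {..<n})" and L: "L = Max (lip ` {..<n})"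
    and kf: "kappa_f = L / m" and kL: "kappa_L = 1 / lambda_min_nonzero Lap"
    and c: "0 < c" "c < 1 / (2 * L)" and X0: "X0 \<in> carrier_mat n p"
    and opt: "optimal_solution n p f r Xopt"
  have m_le: "m \<le> mu i" and L_ge: "lip i \<le> L" if "i < n" for i
    using that by (auto simp: m L)
  have m0: "0 < m"
    unfolding m using n f by (subst Min_gr_iff) (auto simp: lessThan_empty_iff)
  have "mu 0 \<le> lip 0"
    using f n by (intro lipschitz_constant_ge_convexity_modulus[OF p, of "f 0"]) auto
  then have mL: "m \<le> L"
    using m_le[of 0] L_ge[of 0] n by simp
  have cL: "2 * c * L < 1"
    using c mL m0 by (simp add: field_simps)
  let ?l = "lambda_min_nonzero Lap"
  define \<delta> where "\<delta> = c * m * ?l / 8"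
  obtain K where K: "K \<ge> 0" "\<And>k. (frobenius_norm (mirror_extra n p E Lap f r c X0 (Suc k) - Xopt))\<^sup>2
      \<le> K * (1 - \<delta>) ^ k"
    unfolding Lap \<delta>_def
    by (rule mirror_extra_linear_convergence[of n p E U r f lip mu L m c X0 Xopt])
      (use n p E U A top r f L_ge m_le m0 mL c cL X0 opt Lap in auto)
  have l: "0 < ?l" "?l \<le> 1"
    using lambda_min_nonzero_pos[OF n U] lambda_min_nonzero_le_1[OF n U] top by (auto simp: Lap)
  have \<delta>: "0 < \<delta>" "\<delta> \<le> 1 / 2"
  proof -
    show "0 < \<delta>" using c m0 l by (simp add: \<delta>_def)
    have "c * m \<le> 1"
      using mult_left_mono[OF mL less_imp_le[OF c(1)]] cL by (simp add: mult.assoc)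
    then have "c * m * ?l \<le> 1 * 1"
      using l c m0 cL by (intro mult_mono) auto
    then show "\<delta> \<le> 1 / 2" by (simp add: \<delta>_def)
  qed
  have C: "8 / (c * L) * kappa_L * kappa_f = 1 / \<delta>"
    using c m0 mL l by (simp add: kf kL \<delta>_def field_simps)
  show "\<exists>M>0. \<forall>(\<epsilon> :: real) (k :: nat).
      0 < \<epsilon> \<and> \<epsilon> < 1 \<and> real k \<ge> 8 / (c * L) * kappa_L * kappa_f * ln (1 / \<epsilon>) \<longrightarrow>
      (frobenius_norm (mirror_extra n p E Lap f r c X0 k - Xopt))\<^sup>2 \<le> M * \<epsilon>"
  proof (intro exI[of _ "2 * K + 1"] conjI allI impI; (elim conjE)?)
    show "0 < 2 * K + 1" using K(1) by simp
    fix \<epsilon> :: real and k :: nat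
    assume \<epsilon>: "0 < \<epsilon>" "\<epsilon> < 1" and k: "real k \<ge> 8 / (c * L) * kappa_L * kappa_f * ln (1 / \<epsilon>)"
    obtain j where j: "k = Suc j" "(1 - \<delta>) ^ j \<le> 2 * \<epsilon>"
      using geometric_decay_complexity[OF \<delta> \<epsilon> k[unfolded C]] .
    have "(frobenius_norm (mirror_extra n p E Lap f r c X0 k - Xopt))\<^sup>2 \<le> K * (1 - \<delta>) ^ j"
      unfolding j(1) by (rule K(2))
    also have "\<dots> \<le> K * (2 * \<epsilon>)"
      using K(1) j(2) by (rule mult_left_mono[rotated])
    also have "\<dots> \<le> (2 * K + 1) * \<epsilon>"
      using \<epsilon> by (simp add: algebra_simps)
    finally show "(frobenius_norm (mirror_extra n p E Lap f r c X0 k - Xopt))\<^sup>2 \<le> (2 * K + 1) * \<epsilon>" .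
  qed
qed

end
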